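(* Let $\mathcal{G}_1=(\mathcal{V}_1,\mathcal{E}_1,e_1),\dots,\mathcal{G}_n=(\mathcal{V}_n,\mathcal{E}_n,e_n)$ be finite rooted graphs with edge colorings $c_i:\mathcal{E}_i\to\mathcal{C}_i$, where the color sets $\mathcal{C}_1,\dots,\mathcal{C}_n$ are pairwise disjoint, let $\mathcal{C}=\bigcup_{i=1}^n\mathcal{C}_i$, and let $(\mathcal{G},c)$ be a relator graph with colors in $\mathcal{C}$, where $\mathcal{G}=(\mathcal{V},\mathcal{E})$ with $\mathcal{V}=[k]$. Assume $\mathcal{G}$ is equipped with edge weights $a$ and vertex potential $b$, and let $J$ denote the Jacobi operator on the amalgamated free product $\ast_{(\mathcal{G},c)}\{(\mathcal{G}_i,c_i)\}_{i=1}^n$ with the lifted edge weights $\tilde a$ and vertex potential $\tilde b$. For every $i\in[n]$ and every $\alpha\in\mathcal{C}_i$, let $X_\alpha$ be the Jacobi matrix of $\mathcal{G}[\alpha]$ (with the edge weights and vertex potential inherited from $\mathcal{G}$) and let $A_\alpha$ be the adjacency matrix of $\mathcal{G}_i[\alpha]$. Then there exist an operator-valued probability space $(\mathcal{A},E,M_k(\mathbb{C}))$ and random variables $D,T_1,\dots,T_n\in\mathcal{A}$ with the following properties: (i) (Path counting) If $T:=D+T_1+\cdots+T_n$, then for every natural number $p$ and all $i,j\in[k]$, $$E[T^p](i,j)=J^p\big((i,e),(j,e)\big).$$ (ii) (Freeness with amalgamation) The $T_i$ are free with amalgamation over $M_k(\mathbb{C})$ with respect to $E$. Moreover, $D$ is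 free with amalgamation over $M_k(\mathbb{C})$ from any other element of $\mathcal{A}$. (iii) (Equal in distribution) Fix $i\in[n]$, let $m_i:=|\mathcal{V}_i|$, and note that $X_\alpha\otimes A_\alpha\in M_k(\mathbb{C})\otimes M_{m_i}(\mathbb{C})$ for every $\alpha\in\mathcal{C}_i$. View $M_{m_i}(\mathbb{C})\cong B(\ell^2(\mathcal{V}_i))$ as a non-commutative probability space with the functional $\varphi_i(A)=\langle\delta_{e_i},A\delta_{e_i}\rangle$ induced by the root of $\mathcal{G}_i$, and consider the $M_k(\mathbb{C})$-valued probability space $(M_k(\mathbb{C})\otimes M_{m_i}(\mathbb{C}),E_i,M_k(\mathbb{C}))$ with $E_i=\mathrm{Id}_{M_k(\mathbb{C})}\otimes\varphi_i$. Then $$\sum_{\alpha\in\mathcal{C}_i}X_\alpha\otimes A_\alpha$$ has the same distribution with respect to $E_i$ as $T_i$ has with respect to $E$. Moreover, $D$ has with respect to $E$ the same distribution as the matrix $\mathrm{diag}(b_1,\dots,b_k)$ has in the space $(M_k(\mathbb{C}),\mathrm{Id},M_k(\mathbb{C}))$.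
   Context: Graphs. A graph is undirected, with loops and multi-edges allowed, and is described by a vertex set and a set of directed edges; each directed edge $f$ has a source $\sigma(f)$, a target $\tau(f)$, and a reversed edge $\check f$ (edge reversal is an involution with $\sigma(\check f)=\tau(f)$, $\tau(\check f)=\sigma(f)$). A directed edge with source $x$ and target $y$ is also written $(x,y)$. The relator graph may have half-loops (loops with $\check f=f$). An edge coloring gives $f$ and $\check f$ the same color. $\mathcal{G}_i=(\mathcal{V}_i,\mathcal{E}_i,e_i)$ means vertex set $\mathcal{V}_i$, edge set $\mathcal{E}_i$, root $e_i\in\mathcal{V}_i$. A relator graph with colors in a finite set $\mathcal{C}$ is a finite graph $\mathcal{G}=(\mathcal{V},\mathcal{E})$ together with an edge coloring $c:\mathcal{E}\to\mathcal{C}$. Edge weights are a function $a:\mathcal{E}\to\mathbb{R}$ with $a_f=a_{\check f}$; a vertex potential is a function $b:\mathcal{V}\to\mathbb{R}$. The Jacobi operator (Jacobi matrix) of a graph with edge weights $a$ and potential $b$ acts on $\ell^2$ of the vertex set by $(A\xi)(u)=b_u\xi(u)+\sum_{f:\sigma(f)=u}a_f\,\xi(\tau(f))$. The adjacency matrix is the case $a\equiv1$, $b\equiv0$. For an operator $S$ on $\ell^2$ of a vertex set, $S(x,y)=\langle\delta_x,S\delta_y\rangle$. For a color $\alpha$, $\mathcal{G}[\alpha]$ (resp. $\mathcal{G}_i[\alpha]$) is the graph with the same vertex set as $\mathcal{G}$ (resp. $\mathcal{G}_i$) but including only the edges of color $\alpha$; if $\mathcal{G}$ has edge weights and a vertex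 potential, then $\mathcal{G}[\alpha]$ inherits both in the obvious way. Words. Let $\overset{\circ}{\mathcal{V}}_i=\mathcal{V}_i\setminus\{e_i\}$ (regarded as disjoint for different $i$), and $$\ast\{\mathcal{V}_i\}_{i=1}^n=\{e\}\cup\{v_m\cdots v_1: m\ge1,\ v_j\in\overset{\circ}{\mathcal{V}}_{i_j},\ i_j\ne i_{j+1}\text{ for }1\le j\le m-1\},$$ where $e$ is the empty word, and each root $e_i$ also plays the role of the empty word: $e_iw=we_i=w$. Amalgamated free product of graphs. $\ast_{(\mathcal{G},c)}\{(\mathcal{G}_i,c_i)\}_{i=1}^n$ is the $k$-rooted graph with vertex set $[k]\times\ast\{\mathcal{V}_i\}_{i=1}^n$, with edge set $$\big\{\big((l,vw),(l',v'w)\big):(v,v')\in\mathcal{E}_j\text{ for some }j\in[n],\ (l,l')\in\mathcal{E},\ c(l,l')=c_j(v,v')\big\},$$ where it is assumed that $w,vw,v'w\in\ast\{\mathcal{V}_i\}_{i=1}^n$, and with roots $(1,e),\dots,(k,e)$. The lifted coefficients are $\tilde a_{((l,vw),(l',v'w))}=a_{(l,l')}$ and $\tilde b_{(l,w)}=b_l$. Operator-valued probability. A non-commutative probability space is a unital complex algebra with a unital linear functional. An operator-valued (or $\mathcal{B}$-valued) probability space $(\mathcal{A},E,\mathcal{B})$ consists of a unital algebra $\mathcal{A}$, a subalgebra $\mathcal{B}\subset\mathcal{A}$ containing $1_{\mathcal{A}}$, and a linear map $E:\mathcal{A}\to\mathcal{B}$ with $E|_{\mathcal{B}}=\mathrm{Id}$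 and $E[b_1xb_2]=b_1E[x]b_2$ for $x\in\mathcal{A}$, $b_1,b_2\in\mathcal{B}$. In $M_k(\mathbb{C})\otimes M_{m}(\mathbb{C})$, the algebra $M_k(\mathbb{C})$ is identified with $M_k(\mathbb{C})\otimes 1$. Subalgebras $\mathcal{A}_i\supset\mathcal{B}$ of $\mathcal{A}$ are free with amalgamation over $\mathcal{B}$ if $E(x_1\cdots x_m)=0$ whenever $x_r\in\mathcal{A}_{j_r}$, $j_r\ne j_{r+1}$ for all $1\le r<m$, and $E(x_r)=0$ for all $r$; elements are free with amalgamation over $\mathcal{B}$ if the subalgebras they generate (together with $\mathcal{B}$) are. Elements $x$ of $(\mathcal{A},E,\mathcal{B})$ and $x'$ of $(\mathcal{A}',E',\mathcal{B})$ have the same distribution if $E[\beta_0x\beta_1x\cdots x\beta_p]=E'[\beta_0x'\beta_1x'\cdots x'\beta_p]$ for all $p\ge0$ and $\beta_0,\dots,\beta_p\in\mathcal{B}$.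
   Formalization: X_α is taken with the inherited edge weights but zero vertex potential (with b on its diagonal, (i) fails); and a loop at the root e_j is attached at a vertex w of the product only when w does not begin with a letter of V_j (otherwise (i) fails). *)

theory Defs
  imports
    "Graph_Theory.Digraph"
    "HOL-Algebra.Module"
    "HOL-Algebra.Subrings"
    "HOL-Analysis.Infinite_Sum"
begin

section \<open>Graphs and edge colorings\<close>

text \<open>Arcs are the directed edges, \<open>tail\<close> is the source and \<open>head\<close> the target. Loops, multi-edges
  and half-loops (\<open>rev f = f\<close>) are all permitted; the library locale \<open>bidirected_digraph\<close> is not
  usable because it excludes half-loops.\<close>

locale undirected_graph = wf_digraph G for G :: "('v, 'e) pre_digraph" +
  fixes rev :: "'e \<Rightarrow> 'e"
  assumes rev_in_arcs: "f \<in> arcs G \<Longrightarrow> rev f \<in> arcs G"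
    and rev_rev: "f \<in> arcs G \<Longrightarrow> rev (rev f) = f"
    and tail_rev: "f \<in> arcs G \<Longrightarrow> tail G (rev f) = head G f"
    and head_rev: "f \<in> arcs G \<Longrightarrow> head G (rev f) = tail G f"

locale colored_graph = undirected_graph G rev for G :: "('v, 'e) pre_digraph" and rev +
  fixes c :: "'e \<Rightarrow> 'c" and C :: "'c set"
  assumes color_in: "f \<in> arcs G \<Longrightarrow> c f \<in> C"
    and color_rev: "f \<in> arcs G \<Longrightarrow> c (rev f) = c f"

locale finite_colored_graph = colored_graph G rev c C + fin_digraph G
  for G :: "('v, 'e) pre_digraph" and rev and c :: "'e \<Rightarrow> 'c" and C

locale finite_rooted_colored_graph = finite_colored_graph G rev c C
  for G :: "('v, 'e) pre_digraph" and rev and c :: "'e \<Rightarrow> 'c" and C +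
  fixes root :: 'v
  assumes root_in: "root \<in> verts G"

definition color_subgraph :: "('v, 'e) pre_digraph \<Rightarrow> ('e \<Rightarrow> 'c) \<Rightarrow> 'c \<Rightarrow> ('v, 'e) pre_digraph" where
  "color_subgraph G c \<alpha> = G\<lparr>arcs := {f \<in> arcs G. c f = \<alpha>}\<rparr>"


section \<open>Jacobi operators\<close>

type_synonym 'v operator = "('v \<Rightarrow> complex) \<Rightarrow> ('v \<Rightarrow> complex)"

text \<open>In a locally finite graph the sum is finite, so the formula makes sense for every function on
  the vertices and no square-summability has to be imposed on \<open>\<xi>\<close>.\<close>

definition jacobi :: "('v, 'e) pre_digraph \<Rightarrow> ('e \<Rightarrow> real) \<Rightarrow> ('v \<Rightarrow> real) \<Rightarrow> 'v operator" where
  "jacobi G a b \<xi> =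
     (\<lambda>u. complex_of_real (b u) * \<xi> u
        + (\<Sum>f\<in>out_arcs G u. complex_of_real (a f) * \<xi> (head G f)))"

definition adjacency :: "('v, 'e) pre_digraph \<Rightarrow> 'v operator" where
  "adjacency G = jacobi G (\<lambda>_. 1) (\<lambda>_. 0)"

definition delta :: "'v \<Rightarrow> 'v \<Rightarrow> complex" where
  "delta x = (\<lambda>u. if u = x then 1 else 0)"

definition l2_inner :: "'v set \<Rightarrow> ('v \<Rightarrow> complex) \<Rightarrow> ('v \<Rightarrow> complex) \<Rightarrow> complex" where
  "l2_inner V \<xi> \<eta> = (\<Sum>\<^sub>\<infinity>u\<in>V. cnj (\<xi> u) * \<eta> u)"

definition entry :: "'v set \<Rightarrow> 'v operator \<Rightarrow> 'v \<Rightarrow> 'v \<Rightarrow> complex" where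
  "entry V S x y = l2_inner V (delta x) (S (delta y))"


section \<open>Unital complex algebras\<close>

definition complex_field :: "complex ring" where
  "complex_field = \<lparr>carrier = UNIV, monoid.mult = (*), one = 1, zero = 0, add = (+)\<rparr>"

locale complex_algebra = module complex_field A + ring A
  for A :: "(complex, 'x) module" (structure) +
  assumes smult_mult_left:
      "\<lbrakk>x \<in> carrier A; y \<in> carrier A\<rbrakk> \<Longrightarrow> (z \<odot> x) \<otimes> y = z \<odot> (x \<otimes> y)"
    and smult_mult_right:
      "\<lbrakk>x \<in> carrier A; y \<in> carrier A\<rbrakk> \<Longrightarrow> x \<otimes> (z \<odot> y) = z \<odot> (x \<otimes> y)"

text \<open>Unital subalgebras.\<close>

definition complex_subalgebra :: "(complex, 'x) module \<Rightarrow> 'x set \<Rightarrow> bool" where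
  "complex_subalgebra A S \<longleftrightarrow> subring S A \<and> (\<forall>z. \<forall>x\<in>S. z \<odot>\<^bsub>A\<^esub> x \<in> S)"

definition generated_subalgebra :: "(complex, 'x) module \<Rightarrow> 'x set \<Rightarrow> 'x set" where
  "generated_subalgebra A X = \<Inter>{S. complex_subalgebra A S \<and> X \<subseteq> S}"


section \<open>Operator-valued probability\<close>

text \<open>The subalgebra \<open>B \<subseteq> A\<close> is given by an algebra \<open>B\<close> and a unital embedding \<open>\<iota>\<close> of \<open>B\<close> into \<open>A\<close>
  (injective because \<open>E\<close> is a left inverse), so that several spaces can share the same \<open>B\<close>.\<close>

locale ov_prob_space = A: complex_algebra A + B: complex_algebra B
  for A :: "(complex, 'x) module" and B :: "(complex, 'y) module" +
  fixes \<iota> :: "'y \<Rightarrow> 'x" and E :: "'x \<Rightarrow> 'y"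
  assumes embed_hom: "\<iota> \<in> ring_hom B A"
    and embed_smult: "\<beta> \<in> carrier B \<Longrightarrow> \<iota> (z \<odot>\<^bsub>B\<^esub> \<beta>) = z \<odot>\<^bsub>A\<^esub> \<iota> \<beta>"
    and E_closed: "x \<in> carrier A \<Longrightarrow> E x \<in> carrier B"
    and E_add: "\<lbrakk>x \<in> carrier A; y \<in> carrier A\<rbrakk> \<Longrightarrow> E (x \<oplus>\<^bsub>A\<^esub> y) = E x \<oplus>\<^bsub>B\<^esub> E y"
    and E_smult: "x \<in> carrier A \<Longrightarrow> E (z \<odot>\<^bsub>A\<^esub> x) = z \<odot>\<^bsub>B\<^esub> E x"
    and E_embed: "\<beta> \<in> carrier B \<Longrightarrow> E (\<iota> \<beta>) = \<beta>"
    and E_bimodule: "\<lbrakk>\<beta>\<^sub>1 \<in> carrier B; x \<in> carrier A; \<beta>\<^sub>2 \<in> carrier B\<rbrakk> \<Longrightarrow>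
      E (\<iota> \<beta>\<^sub>1 \<otimes>\<^bsub>A\<^esub> x \<otimes>\<^bsub>A\<^esub> \<iota> \<beta>\<^sub>2) = \<beta>\<^sub>1 \<otimes>\<^bsub>B\<^esub> E x \<otimes>\<^bsub>B\<^esub> \<beta>\<^sub>2"

text \<open>A list entry \<open>(j, x)\<close> is a factor \<open>x\<close> taken from the \<open>j\<close>-th subalgebra.\<close>

definition free_subalgebras ::
    "(complex, 'x) module \<Rightarrow> (complex, 'y) module \<Rightarrow> ('x \<Rightarrow> 'y) \<Rightarrow> 'i set \<Rightarrow> ('i \<Rightarrow> 'x set) \<Rightarrow> bool" where
  "free_subalgebras A B E I S \<longleftrightarrow>
     (\<forall>ps. ps \<noteq> [] \<longrightarrow> distinct_adj (map fst ps) \<longrightarrow>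
        (\<forall>(j, x)\<in>set ps. j \<in> I \<and> x \<in> S j \<and> E x = \<zero>\<^bsub>B\<^esub>) \<longrightarrow>
        E (foldr (\<otimes>\<^bsub>A\<^esub>) (map snd ps) \<one>\<^bsub>A\<^esub>) = \<zero>\<^bsub>B\<^esub>)"

definition free_elements ::
    "(complex, 'x) module \<Rightarrow> (complex, 'y) module \<Rightarrow> ('y \<Rightarrow> 'x) \<Rightarrow> ('x \<Rightarrow> 'y) \<Rightarrow> 'i set \<Rightarrow> ('i \<Rightarrow> 'x) \<Rightarrow> bool" where
  "free_elements A B \<iota> E I X \<longleftrightarrow>
     free_subalgebras A B E I (\<lambda>i. generated_subalgebra A (insert (X i) (\<iota> ` carrier B)))"

definition free_pair ::
    "(complex, 'x) module \<Rightarrow> (complex, 'y) module \<Rightarrow> ('y \<Rightarrow> 'x) \<Rightarrow> ('x \<Rightarrow> 'y) \<Rightarrow> 'x \<Rightarrow> 'x \<Rightarrow> bool" where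
  "free_pair A B \<iota> E x y \<longleftrightarrow> free_elements A B \<iota> E UNIV (\<lambda>s. if s then x else y)"

text \<open>\<open>ov_moment A \<iota> E x \<beta>\<^sub>0 [\<beta>\<^sub>1, \<dots>, \<beta>\<^sub>p]\<close> is \<open>E[\<beta>\<^sub>0 x \<beta>\<^sub>1 x \<cdots> x \<beta>\<^sub>p]\<close>.\<close>

definition ov_moment ::
    "(complex, 'x) module \<Rightarrow> ('y \<Rightarrow> 'x) \<Rightarrow> ('x \<Rightarrow> 'y) \<Rightarrow> 'x \<Rightarrow> 'y \<Rightarrow> 'y list \<Rightarrow> 'y" where
  "ov_moment A \<iota> E x \<beta>\<^sub>0 \<beta>s = E (foldl (\<lambda>y \<beta>. y \<otimes>\<^bsub>A\<^esub> x \<otimes>\<^bsub>A\<^esub> \<iota> \<beta>) (\<iota> \<beta>\<^sub>0) \<beta>s)"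

definition same_distribution ::
    "(complex, 'y) module \<Rightarrow>
     (complex, 'x) module \<Rightarrow> ('y \<Rightarrow> 'x) \<Rightarrow> ('x \<Rightarrow> 'y) \<Rightarrow> 'x \<Rightarrow>
     (complex, 'z) module \<Rightarrow> ('y \<Rightarrow> 'z) \<Rightarrow> ('z \<Rightarrow> 'y) \<Rightarrow> 'z \<Rightarrow> bool" where
  "same_distribution B A \<iota> E x A' \<iota>' E' x' \<longleftrightarrow>
     (\<forall>\<beta>\<^sub>0\<in>carrier B. \<forall>\<beta>s. set \<beta>s \<subseteq> carrier B \<longrightarrow>
        ov_moment A \<iota> E x \<beta>\<^sub>0 \<beta>s = ov_moment A' \<iota>' E' x' \<beta>\<^sub>0 \<beta>s)"


section \<open>Matrix algebras and tensor products\<close>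

text \<open>Matrices indexed by a finite set \<open>I\<close> are functions that vanish off \<open>I \<times> I\<close>. Thus
  \<open>mat_alg {1..k}\<close> is \<open>M\<^sub>k(\<complex>)\<close>, \<open>mat_alg V\<close> is \<open>B(\<ell>\<^sup>2(V))\<close>, and \<open>M\<^sub>k(\<complex>) \<otimes> B(\<ell>\<^sup>2(V))\<close> is
  \<open>mat_alg ({1..k} \<times> V)\<close> with \<open>tensor\<close> (the Kronecker product) giving the elementary tensors.\<close>

type_synonym 'i cmat = "'i \<Rightarrow> 'i \<Rightarrow> complex"

definition mat_alg :: "'i set \<Rightarrow> (complex, 'i cmat) module" where
  "mat_alg I =
     \<lparr>carrier = {M. \<forall>x y. M x y \<noteq> 0 \<longrightarrow> x \<in> I \<and> y \<in> I},
      monoid.mult = (\<lambda>M N x y. \<Sum>z\<in>I. M x z * N z y),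
      one = (\<lambda>x y. if x = y \<and> x \<in> I then 1 else 0),
      zero = (\<lambda>x y. 0),
      add = (\<lambda>M N x y. M x y + N x y),
      smult = (\<lambda>c M x y. c * M x y)\<rparr>"

definition op_mat :: "'i set \<Rightarrow> 'i operator \<Rightarrow> 'i cmat" where
  "op_mat I S = (\<lambda>x y. if x \<in> I \<and> y \<in> I then entry I S x y else 0)"

definition diag_mat :: "'i set \<Rightarrow> ('i \<Rightarrow> real) \<Rightarrow> 'i cmat" where
  "diag_mat I b = (\<lambda>x y. if x = y \<and> x \<in> I then complex_of_real (b x) else 0)"

definition tensor :: "'i cmat \<Rightarrow> 'v cmat \<Rightarrow> ('i \<times> 'v) cmat" where
  "tensor X M = (\<lambda>(i, u) (j, v). X i j * M u v)"

definition tensor_embed :: "'v set \<Rightarrow> 'i cmat \<Rightarrow> ('i \<times> 'v) cmat" where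
  "tensor_embed V X = tensor X \<one>\<^bsub>mat_alg V\<^esub>"

definition root_functional :: "'v \<Rightarrow> 'v cmat \<Rightarrow> complex" where
  "root_functional e M = M e e"

text \<open>\<open>Id \<otimes> \<phi>\<^sub>e\<close>, where \<open>\<phi>\<^sub>e\<close> is \<open>root_functional e\<close>: apply \<open>\<phi>\<^sub>e\<close> to each block.\<close>

definition tensor_expectation :: "'v \<Rightarrow> ('i \<times> 'v) cmat \<Rightarrow> 'i cmat" where
  "tensor_expectation e M = (\<lambda>i j. root_functional e (\<lambda>u v. M (i, u) (j, v)))"


lemma complex_algebra_mat_alg:
  assumes "finite I"
  shows "complex_algebra (mat_alg I)"
proof -
  have inv: "\<exists>N. (\<forall>x y. N x y \<noteq> 0 \<longrightarrow> x \<in> I \<and> y \<in> I) \<and> (\<lambda>x y. M x y + N x y) = (\<lambda>x y. 0)"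
    if "\<forall>x y. M x y \<noteq> 0 \<longrightarrow> x \<in> I \<and> y \<in> I" for M :: "'a cmat"
    by (rule exI[of _ "\<lambda>x y. - M x y"]) (use that in auto)
  have assoc: "(\<Sum>z\<in>I. (\<Sum>w\<in>I. L x w * M w z) * N z y) = (\<Sum>w\<in>I. L x w * (\<Sum>z\<in>I. M w z * N z y))"
    for L M N :: "'a cmat" and x y
    unfolding sum_distrib_left sum_distrib_right mult.assoc by (rule sum.swap)
  have ab: "abelian_group (mat_alg I)"
  proof (rule abelian_groupI)
    fix M N assume "M \<in> carrier (mat_alg I)" "N \<in> carrier (mat_alg I)"
    then show "M \<oplus>\<^bsub>mat_alg I\<^esub> N \<in> carrier (mat_alg I)"
      by (simp add: mat_alg_def) (metis add_0)
  qed (auto simp: mat_alg_def algebra_simps intro!: inv)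
  have mon: "Group.monoid (mat_alg I)"
  proof (rule monoidI)
    fix L M N assume "L \<in> carrier (mat_alg I)" "M \<in> carrier (mat_alg I)" "N \<in> carrier (mat_alg I)"
    show "L \<otimes>\<^bsub>mat_alg I\<^esub> M \<otimes>\<^bsub>mat_alg I\<^esub> N = L \<otimes>\<^bsub>mat_alg I\<^esub> (M \<otimes>\<^bsub>mat_alg I\<^esub> N)"
      by (simp add: mat_alg_def assoc)
  next
    fix M N assume "M \<in> carrier (mat_alg I)" "N \<in> carrier (mat_alg I)"
    then show "M \<otimes>\<^bsub>mat_alg I\<^esub> N \<in> carrier (mat_alg I)"
      by (auto simp: mat_alg_def elim!: sum.not_neutral_contains_not_neutral)
  next
    fix M assume "M \<in> carrier (mat_alg I)"
    then have M: "M x y = 0" if "x \<notin> I \<or> y \<notin> I" for x y using that by (auto simp: mat_alg_def)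
    show "\<one>\<^bsub>mat_alg I\<^esub> \<otimes>\<^bsub>mat_alg I\<^esub> M = M"
    proof (intro ext)
      fix x y
      show "(\<one>\<^bsub>mat_alg I\<^esub> \<otimes>\<^bsub>mat_alg I\<^esub> M) x y = M x y"
        using assms M by (cases "x \<in> I") (auto simp: mat_alg_def if_distrib[of "\<lambda>t. t * _"] cong: if_cong conj_cong)
    qed
    show "M \<otimes>\<^bsub>mat_alg I\<^esub> \<one>\<^bsub>mat_alg I\<^esub> = M"
    proof (intro ext)
      fix x y
      show "(M \<otimes>\<^bsub>mat_alg I\<^esub> \<one>\<^bsub>mat_alg I\<^esub>) x y = M x y"
        using assms M by (cases "y \<in> I") (auto simp: mat_alg_def if_distrib[of "\<lambda>t. _ * t"] cong: if_cong conj_cong)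
    qed
  qed (auto simp: mat_alg_def)
  have "ring (mat_alg I)"
    by (rule ringI[OF ab mon]) (auto simp: mat_alg_def fun_eq_iff algebra_simps sum.distrib)
  moreover have "cring complex_field"
    by (rule cringI, rule abelian_groupI, unfold complex_field_def)
      (auto intro!: comm_monoidI simp: algebra_simps intro: exI[of _ "- x" for x :: complex])
  then have "module complex_field (mat_alg I)"
    by (rule moduleI[OF _ ab]) (auto simp: mat_alg_def complex_field_def algebra_simps)
  ultimately show ?thesis
    by (intro complex_algebra.intro complex_algebra_axioms.intro)
      (auto simp: mat_alg_def fun_eq_iff sum_distrib_left algebra_simps)
qed

lemma ov_prob_space_mat_alg:
  assumes "finite I"
  shows "ov_prob_space (mat_alg I) (mat_alg I) id id"
proof -
  interpret complex_algebra "mat_alg I" by (rule complex_algebra_mat_alg) fact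
  show ?thesis by unfold_locales (auto simp: ring_hom_def)
qed

lemma tensor_expectation_tensor:
  "tensor_expectation e (tensor X M) = root_functional e M \<odot>\<^bsub>mat_alg I\<^esub> X"
  by (simp add: tensor_expectation_def tensor_def root_functional_def mat_alg_def fun_eq_iff)

lemma tensor_mult:
  "tensor X M \<otimes>\<^bsub>mat_alg (I \<times> V)\<^esub> tensor Y N =
     tensor (X \<otimes>\<^bsub>mat_alg I\<^esub> Y) (M \<otimes>\<^bsub>mat_alg V\<^esub> N)"
  by (auto simp: tensor_def mat_alg_def fun_eq_iff sum_product sum.cartesian_product algebra_simps
      intro!: sum.cong)

lemma ov_prob_space_tensor:
  fixes I :: "'i set" and V :: "'v set"
  assumes "finite I" "finite V" "e \<in> V"
  shows "ov_prob_space (mat_alg (I \<times> V)) (mat_alg I) (tensor_embed V) (tensor_expectation e)"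
proof -
  interpret A: complex_algebra "mat_alg (I \<times> V)" by (rule complex_algebra_mat_alg) (use assms in auto)
  interpret B: complex_algebra "mat_alg I" by (rule complex_algebra_mat_alg) fact
  interpret M: complex_algebra "mat_alg V" by (rule complex_algebra_mat_alg) fact
  have embed: "tensor_embed V \<beta> = (\<lambda>(i, u) (j, v). if u = v \<and> u \<in> V then \<beta> i j else 0)" for \<beta> :: "'i cmat"
    by (auto simp: tensor_embed_def tensor_def mat_alg_def fun_eq_iff)
  have mult: "tensor_embed V (\<beta> \<otimes>\<^bsub>mat_alg I\<^esub> \<gamma>) =
      tensor_embed V \<beta> \<otimes>\<^bsub>mat_alg (I \<times> V)\<^esub> tensor_embed V \<gamma>" for \<beta> \<gamma> :: "'i cmat"
    by (simp add: tensor_embed_def tensor_mult)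
  have left: "(tensor_embed V \<beta> \<otimes>\<^bsub>mat_alg (I \<times> V)\<^esub> x) (i, e) q = (\<Sum>l\<in>I. \<beta> i l * x (l, e) q)"
    for \<beta> :: "'i cmat" and x i q
    using assms
    by (simp add: embed mat_alg_def sum.cartesian_product' if_distrib[of "\<lambda>t. t * _"]
        cong: if_cong)
  have right: "(x \<otimes>\<^bsub>mat_alg (I \<times> V)\<^esub> tensor_embed V \<beta>) q (j, e) = (\<Sum>l\<in>I. x q (l, e) * \<beta> l j)"
    for \<beta> :: "'i cmat" and x j q
    using assms
    by (simp add: embed mat_alg_def sum.cartesian_product' if_distrib[of "\<lambda>t. _ * t"]
        cong: if_cong)
  show ?thesis
  proof unfold_locales
    show "tensor_embed V \<in> ring_hom (mat_alg I) (mat_alg (I \<times> V))"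
      by (rule ring_hom_memI, auto simp: mult, auto simp: embed mat_alg_def fun_eq_iff split: if_splits)
  next
    fix \<beta>\<^sub>1 x \<beta>\<^sub>2
    show "tensor_expectation e (tensor_embed V \<beta>\<^sub>1 \<otimes>\<^bsub>mat_alg (I \<times> V)\<^esub> x \<otimes>\<^bsub>mat_alg (I \<times> V)\<^esub> tensor_embed V \<beta>\<^sub>2)
        = \<beta>\<^sub>1 \<otimes>\<^bsub>mat_alg I\<^esub> tensor_expectation e x \<otimes>\<^bsub>mat_alg I\<^esub> \<beta>\<^sub>2"
      by (simp add: tensor_expectation_def root_functional_def left right fun_eq_iff)
        (simp add: mat_alg_def)
  qed (use assms in \<open>auto simp: embed tensor_expectation_def root_functional_def mat_alg_def fun_eq_iff\<close>)
qed


section \<open>The amalgamated free product of graphs\<close>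

text \<open>A word \<open>v\<^sub>m \<cdots> v\<^sub>1\<close> is the list whose first entry is \<open>v\<^sub>m\<close>; the letter \<open>v \<in> \<V>\<^sub>j\<close> is tagged as
  \<open>(j, v)\<close> to make the vertex sets disjoint.\<close>

type_synonym 'v word = "(nat \<times> 'v) list"

definition words :: "nat \<Rightarrow> (nat \<Rightarrow> ('v, 'e) pre_digraph) \<Rightarrow> (nat \<Rightarrow> 'v) \<Rightarrow> 'v word set" where
  "words n Gs es =
     {w. (\<forall>(i, v)\<in>set w. i \<in> {1..n} \<and> v \<in> verts (Gs i) - {es i}) \<and> distinct_adj (map fst w)}"

definition prepend :: "(nat \<Rightarrow> 'v) \<Rightarrow> nat \<Rightarrow> 'v \<Rightarrow> 'v word \<Rightarrow> 'v word" where
  "prepend es j v w = (if v = es j then w else (j, v) # w)"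

text \<open>An edge is a triple \<open>(f, (j, g), w)\<close> with \<open>f = (l, l')\<close> in the relator graph \<open>G\<close> and
  \<open>g = (v, v')\<close> in \<open>Gs j\<close> of the same color; indexing by triples retains multiplicities.

  The condition that \<open>w\<close> does not begin with a letter of \<open>\<V>\<^sub>j\<close> follows from the membership conditions
  unless \<open>g\<close> is a loop at the root of \<open>Gs j\<close>. It says that \<open>w\<close> is the root of a copy of \<open>Gs j\<close>; without
  it a loop at the root would be attached to every vertex of every copy, and already for \<open>n = 1\<close>
  the construction would not return \<open>Gs 1\<close>.\<close>

definition afp_arcs ::
    "nat \<Rightarrow> (nat, 'f) pre_digraph \<Rightarrow> ('f \<Rightarrow> 'c) \<Rightarrow>
     (nat \<Rightarrow> ('v, 'e) pre_digraph) \<Rightarrow> (nat \<Rightarrow> 'v) \<Rightarrow> (nat \<Rightarrow> 'e \<Rightarrow> 'c) \<Rightarrow>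
     ('f \<times> (nat \<times> 'e) \<times> 'v word) set" where
  "afp_arcs n G c Gs es cs =
     {(f, (j, g), w). f \<in> arcs G \<and> j \<in> {1..n} \<and> g \<in> arcs (Gs j) \<and> c f = cs j g \<and>
        w \<in> words n Gs es \<and>
        prepend es j (tail (Gs j) g) w \<in> words n Gs es \<and>
        prepend es j (head (Gs j) g) w \<in> words n Gs es \<and>
        (w = [] \<or> fst (hd w) \<noteq> j)}"

definition afp_graph ::
    "nat \<Rightarrow> (nat, 'f) pre_digraph \<Rightarrow> ('f \<Rightarrow> 'c) \<Rightarrow>
     (nat \<Rightarrow> ('v, 'e) pre_digraph) \<Rightarrow> (nat \<Rightarrow> 'v) \<Rightarrow> (nat \<Rightarrow> 'e \<Rightarrow> 'c) \<Rightarrow>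
     (nat \<times> 'v word, 'f \<times> (nat \<times> 'e) \<times> 'v word) pre_digraph" where
  "afp_graph n G c Gs es cs =
     \<lparr>verts = verts G \<times> words n Gs es,
      arcs = afp_arcs n G c Gs es cs,
      tail = (\<lambda>(f, (j, g), w). (tail G f, prepend es j (tail (Gs j) g) w)),
      head = (\<lambda>(f, (j, g), w). (head G f, prepend es j (head (Gs j) g) w))\<rparr>"

definition afp_rev ::
    "('f \<Rightarrow> 'f) \<Rightarrow> (nat \<Rightarrow> 'e \<Rightarrow> 'e) \<Rightarrow>
     'f \<times> (nat \<times> 'e) \<times> 'v word \<Rightarrow> 'f \<times> (nat \<times> 'e) \<times> 'v word" where
  "afp_rev rv revs = (\<lambda>(f, (j, g), w). (rv f, (j, revs j g), w))"

lemma afp_undirected_graph: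
  assumes "\<And>i. i \<in> {1..n} \<Longrightarrow> finite_rooted_colored_graph (Gs i) (revs i) (cs i) (Cs i) (es i)"
    and "finite_colored_graph G rv c C"
  shows "undirected_graph (afp_graph n G c Gs es cs) (afp_rev rv revs)"
proof -
  interpret G: finite_colored_graph G rv c C by fact
  have u: "colored_graph (Gs i) (revs i) (cs i) (Cs i)" if "i \<in> {1..n}" for i
    using assms(1)[OF that] by (simp add: finite_rooted_colored_graph_def finite_colored_graph_def)
  have v: "undirected_graph (Gs i) (revs i)" if "i \<in> {1..n}" for i
    using u[OF that] by (simp add: colored_graph_def)
  show ?thesis
    by unfold_locales
      (auto simp: afp_graph_def afp_arcs_def afp_rev_def
        G.rev_in_arcs G.rev_rev G.tail_rev G.head_rev G.color_rev colored_graph.color_rev[OF u]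
        undirected_graph.rev_in_arcs[OF v] undirected_graph.rev_rev[OF v]
        undirected_graph.tail_rev[OF v] undirected_graph.head_rev[OF v])
qed

lemma afp_locally_finite:
  assumes "\<And>i. i \<in> {1..n} \<Longrightarrow> finite_rooted_colored_graph (Gs i) (revs i) (cs i) (Cs i) (es i)"
    and "finite_colored_graph G rv c C"
  shows "finite (out_arcs (afp_graph n G c Gs es cs) u)"
proof -
  interpret G: finite_colored_graph G rv c C by fact
  have fin: "finite (arcs (Gs i))" if "i \<in> {1..n}" for i
    using assms(1)[OF that]
    by (simp add: finite_rooted_colored_graph_def finite_colored_graph_def fin_digraph_def
        fin_digraph_axioms_def)
  have "out_arcs (afp_graph n G c Gs es cs) u \<subseteq>
      arcs G \<times> (SIGMA j:{1..n}. arcs (Gs j)) \<times> {snd u, tl (snd u)}"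
    by (auto simp: out_arcs_def afp_graph_def afp_arcs_def prepend_def split: if_splits)
  moreover have "finite (arcs G \<times> (SIGMA j:{1..n}. arcs (Gs j)) \<times> {snd u, tl (snd u)})"
    by (intro finite_cartesian_product finite_SigmaI fin) auto
  ultimately show ?thesis by (rule finite_subset)
qed

definition afp_jacobi ::
    "nat \<Rightarrow> (nat, 'f) pre_digraph \<Rightarrow> ('f \<Rightarrow> 'c) \<Rightarrow>
     (nat \<Rightarrow> ('v, 'e) pre_digraph) \<Rightarrow> (nat \<Rightarrow> 'v) \<Rightarrow> (nat \<Rightarrow> 'e \<Rightarrow> 'c) \<Rightarrow>
     ('f \<Rightarrow> real) \<Rightarrow> (nat \<Rightarrow> real) \<Rightarrow> (nat \<times> 'v word) operator" where
  "afp_jacobi n G c Gs es cs a b =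
     jacobi (afp_graph n G c Gs es cs) (\<lambda>(f, _, _). a f) (\<lambda>(l, _). b l)"


section \<open>The matrices attached to a color\<close>

text \<open>The Jacobi matrix of the single-color subgraph of the relator graph carries the inherited edge
  weights only. The vertex potential is accounted for once, by the diagonal variable \<open>D\<close>. Including it
  here as well would make the path-counting identity false: take \<open>n = k = 1\<close>, the one-vertex graph without
  edges and with potential \<open>b = 1\<close> as relator graph, and a single edge, of color \<open>\<alpha>\<close>, as \<open>Gs 1\<close>. Then \<open>J = 1\<close>, while \<open>T = D + T\<^sub>1\<close> would have \<open>E[T\<^sup>2] = 1 + 1\<close>.\<close>

definition relator_color_mat ::
    "('v, 'e) pre_digraph \<Rightarrow> ('e \<Rightarrow> 'c) \<Rightarrow> ('e \<Rightarrow> real) \<Rightarrow> 'c \<Rightarrow> 'v cmat" where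
  "relator_color_mat G c a \<alpha> = op_mat (verts G) (jacobi (color_subgraph G c \<alpha>) a (\<lambda>_. 0))"

definition color_adjacency_mat ::
    "('v, 'e) pre_digraph \<Rightarrow> ('e \<Rightarrow> 'c) \<Rightarrow> 'c \<Rightarrow> 'v cmat" where
  "color_adjacency_mat G c \<alpha> = op_mat (verts G) (adjacency (color_subgraph G c \<alpha>))"

end

theory Submission
  imports Defs
begin

text \<open>The algebra \<open>A\<close> consists of the linear operators on functions on \<open>V = [k] \<times> W\<close>, where \<open>W\<close> is the
  set of words, that is, on the vertex set of the amalgamated free product. The conditional
  expectation is compression to the \<open>k\<close> roots, \<open>E S (i, j) = (S \<delta>) (i, e)\<close> with \<open>\<delta>\<close> the point
  mass at \<open>(j, e)\<close>, and \<open>M\<^sub>k(\<complex>)\<close> acts on the factor \<open>[k]\<close>. No topology is involved: \<open>E\<close> and \<open>J\<close> make sense on arbitrary functions.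

  For each \<open>j\<close>, every word is uniquely \<open>v w\<close> with \<open>v \<in> \<V>\<^sub>j\<close> (the root standing for the empty word)
  and \<open>w\<close> a word that does not begin with a letter of \<open>\<V>\<^sub>j\<close>. So \<open>V\<close> is a disjoint union of copies of
  \<open>[k] \<times> \<V>\<^sub>j\<close>, one for each such \<open>w\<close>, and letting a matrix act on all the copies at once gives a unital
  homomorphism \<open>\<lambda>\<^sub>j\<close> (\<open>factor_op j\<close>) from \<open>M\<^sub>k(\<complex>) \<otimes> B(\<ell>\<^sup>2(\<V>\<^sub>j))\<close> to \<open>A\<close>. It extends the action of \<open>M\<^sub>k(\<complex>)\<close>
  (\<open>factor_op_embed\<close>), and since the roots lie in the copy \<open>w = e\<close> it carries \<open>Id \<otimes> \<phi>\<^sub>j\<close> to \<open>E\<close>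
  (\<open>vacuum_factor_op\<close>). Hence \<open>T\<^sub>j := \<lambda>\<^sub>j(\<Sum>\<^sub>\<alpha> X\<^sub>\<alpha> \<otimes> A\<^sub>\<alpha>)\<close> has the required distribution, whatever the
  matrix is, and the algebra generated by \<open>T\<^sub>j\<close> and \<open>M\<^sub>k(\<complex>)\<close> lies in the range of \<open>\<lambda>\<^sub>j\<close>.

  Freeness is the Fock space argument: applied to a function carried by words that do not begin with
  a letter of \<open>\<V>\<^sub>j\<close>, a centered element of the range of \<open>\<lambda>\<^sub>j\<close> adds exactly one letter from \<open>\<V>\<^sub>j\<close> other
  than the root. An alternating product of centered elements therefore sends the point mass at a root to a
  function carried by nonempty words (\<open>alternating_product_support\<close>), and its expectation vanishes. The
  variable \<open>D\<close> is the image of \<open>diag(b)\<close> in \<open>A\<close>; elements of \<open>M\<^sub>k(\<complex>)\<close> are free from everything because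
  the only centered one is \<open>0\<close> (\<open>free_pair_embed\<close>).

  Finally, an edge of the free product leaving \<open>(l, u)\<close> is a choice of \<open>j\<close>, of an edge of the relator
  graph leaving \<open>l\<close> and of an edge of the same color of \<open>\<G>\<^sub>j\<close> leaving the letter \<open>v\<close> of the
  decomposition \<open>u = v w\<close>, so that \<open>J\<close> and \<open>D + \<Sum>\<^sub>j T\<^sub>j\<close> agree on \<open>V\<close> (\<open>afp_jacobi_eq\<close>,
  \<open>color_sum_mat_sum\<close>); path counting follows by taking powers.\<close>


section \<open>Linear operators supported on a set\<close>

definition cut :: "'u set \<Rightarrow> ('u \<Rightarrow> complex) \<Rightarrow> 'u \<Rightarrow> complex" where
  "cut V \<xi> = (\<lambda>u. if u \<in> V then \<xi> u else 0)"

text \<open>Operators are functions on all of \<open>'u \<Rightarrow> complex\<close>; those that factor through \<open>cut V\<close> on both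
  sides stand for the endomorphisms of the space of functions on \<open>V\<close>, and \<open>cut V\<close> is their unit.\<close>

definition op_alg :: "'u set \<Rightarrow> (complex, 'u operator) module" where
  "op_alg V =
     \<lparr>carrier = {S. (\<forall>\<xi> \<eta>. S (\<lambda>u. \<xi> u + \<eta> u) = (\<lambda>u. S \<xi> u + S \<eta> u)) \<and>
                    (\<forall>z \<xi>. S (\<lambda>u. z * \<xi> u) = (\<lambda>u. z * S \<xi> u)) \<and>
                    (\<forall>\<xi>. S (cut V \<xi>) = S \<xi>) \<and> (\<forall>\<xi>. cut V (S \<xi>) = S \<xi>)},
      monoid.mult = (\<lambda>S R \<xi>. S (R \<xi>)),
      one = cut V,
      zero = (\<lambda>\<xi> u. 0),
      add = (\<lambda>S R \<xi> u. S \<xi> u + R \<xi> u),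
      smult = (\<lambda>z S \<xi> u. z * S \<xi> u)\<rparr>"

lemma op_alg_simps:
  "S \<otimes>\<^bsub>op_alg V\<^esub> R = (\<lambda>\<xi>. S (R \<xi>))"
  "\<one>\<^bsub>op_alg V\<^esub> = cut V"
  "\<zero>\<^bsub>op_alg V\<^esub> = (\<lambda>\<xi> u. 0)"
  "S \<oplus>\<^bsub>op_alg V\<^esub> R = (\<lambda>\<xi> u. S \<xi> u + R \<xi> u)"
  "z \<odot>\<^bsub>op_alg V\<^esub> S = (\<lambda>\<xi> u. z * S \<xi> u)"
  by (simp_all add: op_alg_def)

lemma op_alg_mult_apply: "(S \<otimes>\<^bsub>op_alg V\<^esub> R) \<xi> = S (R \<xi>)"
  by (simp add: op_alg_def)

lemma op_algD:
  assumes "S \<in> carrier (op_alg V)"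
  shows "S (\<lambda>u. \<xi> u + \<eta> u) = (\<lambda>u. S \<xi> u + S \<eta> u)" "S (\<lambda>u. z * \<xi> u) = (\<lambda>u. z * S \<xi> u)"
    "S (cut V \<xi>) = S \<xi>" "cut V (S \<xi>) = S \<xi>" "u \<notin> V \<Longrightarrow> S \<xi> u = 0"
proof -
  show cut: "cut V (S \<xi>) = S \<xi>" using assms by (simp add: op_alg_def)
  show "u \<notin> V \<Longrightarrow> S \<xi> u = 0" by (subst cut[symmetric]) (simp add: cut_def)
qed (use assms in \<open>simp_all add: op_alg_def\<close>)

lemma op_algI:
  assumes "\<And>\<xi> \<eta> u. u \<in> V \<Longrightarrow> S (\<lambda>u. \<xi> u + \<eta> u) u = S \<xi> u + S \<eta> u"
    and "\<And>z \<xi> u. u \<in> V \<Longrightarrow> S (\<lambda>u. z * \<xi> u) u = z * S \<xi> u"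
    and "\<And>\<xi> u. u \<in> V \<Longrightarrow> S (cut V \<xi>) u = S \<xi> u"
    and "\<And>\<xi> u. u \<notin> V \<Longrightarrow> S \<xi> u = 0"
  shows "S \<in> carrier (op_alg V)"
proof -
  have "S (\<lambda>u. \<xi> u + \<eta> u) u = S \<xi> u + S \<eta> u" "S (\<lambda>u. z * \<xi> u) u = z * S \<xi> u"
    "S (cut V \<xi>) u = S \<xi> u" "cut V (S \<xi>) u = S \<xi> u" for \<xi> \<eta> z u
    using assms by (cases "u \<in> V"; simp add: cut_def)+
  then show ?thesis by (simp add: op_alg_def fun_eq_iff)
qed

lemma op_alg_zero: "S \<in> carrier (op_alg V) \<Longrightarrow> S (\<lambda>u. 0) = (\<lambda>u. 0)"
  using op_algD(2)[of S V 0 "\<lambda>u. 0"] by simp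

text \<open>Only finite combinations pass through an operator. That suffices, because \<open>M\<^sub>k(\<complex>)\<close> sends a point
  mass at a root to a finite combination of such point masses.\<close>

lemma op_alg_sum:
  assumes "S \<in> carrier (op_alg V)"
  shows "S (\<lambda>u. \<Sum>x\<in>F. z x * \<eta> x u) = (\<lambda>u. \<Sum>x\<in>F. z x * S (\<eta> x) u)"
proof (induction F rule: infinite_finite_induct)
  case (insert x F)
  then show ?case by (simp add: op_algD(1,2)[OF assms])
qed (simp_all add: op_alg_zero[OF assms])

lemma complex_algebra_op_alg: "complex_algebra (op_alg V)"
proof -
  let ?A = "op_alg V"
  have closed: "S \<oplus>\<^bsub>?A\<^esub> R \<in> carrier ?A" "S \<otimes>\<^bsub>?A\<^esub> R \<in> carrier ?A" "z \<odot>\<^bsub>?A\<^esub> S \<in> carrier ?A"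
    if "S \<in> carrier ?A" "R \<in> carrier ?A" for S R z
    by (rule op_algI; simp add: op_alg_simps op_algD[OF that(1)] op_algD[OF that(2)] algebra_simps)+
  have units: "\<zero>\<^bsub>?A\<^esub> \<in> carrier ?A" "\<one>\<^bsub>?A\<^esub> \<in> carrier ?A"
    by (rule op_algI; simp add: op_alg_simps cut_def)+
  have ab: "abelian_group ?A"
  proof (rule abelian_groupI)
    fix S assume S: "S \<in> carrier ?A"
    show "\<exists>R\<in>carrier ?A. R \<oplus>\<^bsub>?A\<^esub> S = \<zero>\<^bsub>?A\<^esub>"
      by (rule bexI[OF _ closed(3)[OF S S, of "-1"]]) (simp add: op_alg_simps)
  qed (auto simp: closed units, auto simp: op_alg_simps algebra_simps)
  have mon: "Group.monoid ?A"
    by (rule monoidI) (auto simp: closed units, auto simp: op_alg_simps op_algD fun_eq_iff)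
  have "ring ?A"
    by (rule ringI[OF ab mon]) (auto simp: op_alg_simps op_algD fun_eq_iff)
  moreover have "cring complex_field"
    by (rule cringI, rule abelian_groupI, unfold complex_field_def)
      (auto intro!: comm_monoidI simp: algebra_simps intro: exI[of _ "- x" for x :: complex])
  then have "module complex_field ?A"
    by (rule moduleI[OF _ ab])
      (auto simp: closed, auto simp: op_alg_simps complex_field_def algebra_simps)
  ultimately show ?thesis
    by (intro complex_algebra.intro complex_algebra_axioms.intro)
      (auto simp: op_alg_simps op_algD)
qed

lemma finsum_op_alg:
  assumes "finite F" "\<And>i. i \<in> F \<Longrightarrow> S i \<in> carrier (op_alg V)"
  shows "(\<Oplus>\<^bsub>op_alg V\<^esub>i\<in>F. S i) \<xi> u = (\<Sum>i\<in>F. S i \<xi> u)"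
proof -
  interpret complex_algebra "op_alg V" by (rule complex_algebra_op_alg)
  show ?thesis using assms
  proof (induction F rule: finite_induct)
    case (insert i F)
    then have "(\<Oplus>\<^bsub>op_alg V\<^esub>i\<in>insert i F. S i) = S i \<oplus>\<^bsub>op_alg V\<^esub> (\<Oplus>\<^bsub>op_alg V\<^esub>i\<in>F. S i)"
      by (intro finsum_insert) auto
    with insert show ?case by (simp add: op_alg_simps(4))
  qed (simp add: op_alg_simps)
qed

lemma finsum_mat_alg:
  assumes "finite I" "finite F" "\<And>i. i \<in> F \<Longrightarrow> M i \<in> carrier (mat_alg I)"
  shows "(\<Oplus>\<^bsub>mat_alg I\<^esub>i\<in>F. M i) x y = (\<Sum>i\<in>F. M i x y)"
proof -
  interpret complex_algebra "mat_alg I" by (rule complex_algebra_mat_alg) fact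
  show ?thesis using assms(2,3)
  proof (induction F rule: finite_induct)
    case empty
    then show ?case by simp (simp add: mat_alg_def)
  next
    case (insert i F)
    then have "(\<Oplus>\<^bsub>mat_alg I\<^esub>i\<in>insert i F. M i) = M i \<oplus>\<^bsub>mat_alg I\<^esub> (\<Oplus>\<^bsub>mat_alg I\<^esub>i\<in>F. M i)"
      by (intro finsum_insert) auto
    moreover have "(M i \<oplus>\<^bsub>mat_alg I\<^esub> N) x y = M i x y + N x y" for N by (simp add: mat_alg_def)
    ultimately show ?case using insert by simp
  qed
qed


section \<open>Matrices acting on one factor of a decomposition\<close>

text \<open>A bijection \<open>V \<cong> I \<times> W\<close>, with \<open>W\<close> the range of \<open>base\<close> on \<open>V\<close> and \<open>glue\<close> the inverse
  of \<open>u \<mapsto> (idx u, base u)\<close>. A matrix \<open>Y\<close> over \<open>I\<close> then acts on the functions on \<open>V\<close> as \<open>Y \<otimes> 1\<close>. The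
  actions of \<open>M\<^sub>k(\<complex>)\<close> and of \<open>M\<^sub>k(\<complex>) \<otimes> B(\<ell>\<^sup>2(\<V>\<^sub>j))\<close> are both of this kind.\<close>

locale block_decomposition =
  fixes I :: "'i set" and V :: "'u set"
    and idx :: "'u \<Rightarrow> 'i" and base :: "'u \<Rightarrow> 'w" and glue :: "'i \<Rightarrow> 'w \<Rightarrow> 'u"
  assumes finite_I: "finite I"
    and idx_in: "u \<in> V \<Longrightarrow> idx u \<in> I"
    and glue_in: "\<lbrakk>u \<in> V; y \<in> I\<rbrakk> \<Longrightarrow> glue y (base u) \<in> V"
    and glue_idx: "u \<in> V \<Longrightarrow> glue (idx u) (base u) = u"
    and idx_glue: "\<lbrakk>u \<in> V; y \<in> I\<rbrakk> \<Longrightarrow> idx (glue y (base u)) = y"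
    and base_glue: "\<lbrakk>u \<in> V; y \<in> I\<rbrakk> \<Longrightarrow> base (glue y (base u)) = base u"
begin

definition amplify :: "'i cmat \<Rightarrow> 'u operator" where
  "amplify Y \<xi> u = (if u \<in> V then \<Sum>y\<in>I. Y (idx u) y * \<xi> (glue y (base u)) else 0)"

lemma amplify_closed: "amplify Y \<in> carrier (op_alg V)"
  by (rule op_algI)
    (auto simp: amplify_def cut_def glue_in algebra_simps sum.distrib sum_distrib_left intro!: sum.cong)

lemma amplify_smult: "amplify (z \<odot>\<^bsub>mat_alg I\<^esub> Y) = z \<odot>\<^bsub>op_alg V\<^esub> amplify Y"
  by (auto simp: op_alg_simps mat_alg_def amplify_def fun_eq_iff sum_distrib_left mult.assoc)

lemma amplify_mult: "amplify (Y \<otimes>\<^bsub>mat_alg I\<^esub> Z) = amplify Y \<otimes>\<^bsub>op_alg V\<^esub> amplify Z"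
proof (intro ext)
  fix \<xi> u
  show "amplify (Y \<otimes>\<^bsub>mat_alg I\<^esub> Z) \<xi> u = (amplify Y \<otimes>\<^bsub>op_alg V\<^esub> amplify Z) \<xi> u"
  proof (cases "u \<in> V")
    case True
    have "amplify (Y \<otimes>\<^bsub>mat_alg I\<^esub> Z) \<xi> u
        = (\<Sum>y\<in>I. \<Sum>z\<in>I. Y (idx u) z * (Z z y * \<xi> (glue y (base u))))"
      using True by (simp add: amplify_def mat_alg_def sum_distrib_right mult.assoc)
    also have "\<dots> = (\<Sum>z\<in>I. \<Sum>y\<in>I. Y (idx u) z * (Z z y * \<xi> (glue y (base u))))"
      by (rule sum.swap)
    also have "\<dots> = (amplify Y \<otimes>\<^bsub>op_alg V\<^esub> amplify Z) \<xi> u"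
      using True
      by (simp add: op_alg_simps amplify_def glue_in idx_glue base_glue sum_distrib_left)
    finally show ?thesis .
  qed (simp add: op_alg_simps amplify_def)
qed

lemma amplify_one: "amplify \<one>\<^bsub>mat_alg I\<^esub> = \<one>\<^bsub>op_alg V\<^esub>"
proof (intro ext)
  fix \<xi> u
  show "amplify \<one>\<^bsub>mat_alg I\<^esub> \<xi> u = \<one>\<^bsub>op_alg V\<^esub> \<xi> u"
    by (simp add: op_alg_simps amplify_def cut_def mat_alg_def if_distrib[of "\<lambda>t. t * _"]
        finite_I idx_in glue_idx cong: if_cong conj_cong)
qed

lemma amplify_hom: "amplify \<in> ring_hom (mat_alg I) (op_alg V)"
proof (rule ring_hom_memI)
  show "amplify (Y \<oplus>\<^bsub>mat_alg I\<^esub> Z) = amplify Y \<oplus>\<^bsub>op_alg V\<^esub> amplify Z" for Y Z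
    by (auto simp: op_alg_simps mat_alg_def amplify_def fun_eq_iff sum.distrib algebra_simps)
qed (simp_all add: amplify_closed amplify_mult amplify_one)

lemma complex_subalgebra_amplify:
  "complex_subalgebra (op_alg V) (amplify ` carrier (mat_alg I))"
proof -
  interpret M: complex_algebra "mat_alg I" by (rule complex_algebra_mat_alg[OF finite_I])
  interpret A: complex_algebra "op_alg V" by (rule complex_algebra_op_alg)
  interpret ring_hom_ring "mat_alg I" "op_alg V" amplify
    by (rule ring_hom_ringI2) (fact M.ring_axioms A.ring_axioms amplify_hom)+
  have "subring (amplify ` carrier (mat_alg I)) (op_alg V)"
    using img_is_subring[OF M.carrier_is_subring] .
  then show ?thesis
    unfolding complex_subalgebra_def
    by (auto simp: amplify_smult[symmetric] intro!: imageI M.smult_closed simp: complex_field_def)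
qed

end


section \<open>Operator-valued generalities\<close>

lemma generated_subalgebra_subset:
  "complex_subalgebra A S \<Longrightarrow> X \<subseteq> S \<Longrightarrow> generated_subalgebra A X \<subseteq> S"
  by (auto simp: generated_subalgebra_def)

text \<open>A homomorphism that respects the copies of \<open>B\<close> and intertwines the expectations carries each word
  \<open>\<beta>\<^sub>0 x \<beta>\<^sub>1 \<cdots> x \<beta>\<^sub>p\<close> to the corresponding word in the image of \<open>x\<close>.\<close>

lemma same_distribution_hom:
  assumes "ov_prob_space A B \<iota> E" "h \<in> ring_hom A A'" "x \<in> carrier A"
    and "\<And>\<beta>. \<beta> \<in> carrier B \<Longrightarrow> h (\<iota> \<beta>) = \<iota>' \<beta>"
    and "\<And>y. y \<in> carrier A \<Longrightarrow> E' (h y) = E y"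
  shows "same_distribution B A \<iota> E x A' \<iota>' E' (h x)"
proof -
  interpret ov_prob_space A B \<iota> E by fact
  let ?m = "\<lambda>y \<beta>. y \<otimes>\<^bsub>A\<^esub> x \<otimes>\<^bsub>A\<^esub> \<iota> \<beta>" and ?m' = "\<lambda>y \<beta>. y \<otimes>\<^bsub>A'\<^esub> h x \<otimes>\<^bsub>A'\<^esub> \<iota>' \<beta>"
  have \<iota>: "\<iota> \<beta> \<in> carrier A" if "\<beta> \<in> carrier B" for \<beta>
    using embed_hom that by (rule ring_hom_closed)
  have "foldl ?m y \<beta>s \<in> carrier A \<and> h (foldl ?m y \<beta>s) = foldl ?m' (h y) \<beta>s"
    if "y \<in> carrier A" "set \<beta>s \<subseteq> carrier B" for y \<beta>s
    using that
  proof (induction \<beta>s arbitrary: y)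
    case (Cons \<beta> \<beta>s)
    then have "?m y \<beta> \<in> carrier A" "h (?m y \<beta>) = ?m' (h y) \<beta>"
      using assms(3) by (auto simp: \<iota> ring_hom_mult[OF assms(2)] assms(4))
    with Cons show ?case by simp
  qed simp
  then show ?thesis
    unfolding same_distribution_def ov_moment_def
    by (metis \<iota> assms(4,5))
qed

lemma same_distribution_sym:
  "same_distribution B A \<iota> E x A' \<iota>' E' x' \<Longrightarrow> same_distribution B A' \<iota>' E' x' A \<iota> E x"
  by (simp add: same_distribution_def)

text \<open>The algebra generated by an element of \<open>B\<close> is \<open>B\<close> itself, on which \<open>E\<close> is injective: a centered
  element of it is \<open>0\<close> and kills any product. Without such a factor, an alternating product has only
  one factor, which is centered.\<close>

lemma (in ov_prob_space) free_pair_embed: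
  assumes "\<beta> \<in> carrier B" "x \<in> carrier A"
  shows "free_pair A B \<iota> E (\<iota> \<beta>) x"
proof -
  let ?S = "\<lambda>s. generated_subalgebra A (insert (if s then \<iota> \<beta> else x) (\<iota> ` carrier B))"
  interpret h: ring_hom_ring B A \<iota>
    by (rule ring_hom_ringI2) (fact B.ring_axioms A.ring_axioms embed_hom)+
  have B_sub: "complex_subalgebra A (\<iota> ` carrier B)"
    unfolding complex_subalgebra_def
    using h.img_is_subring[OF B.carrier_is_subring]
    by (auto simp: embed_smult[symmetric] complex_field_def intro!: imageI B.smult_closed)
  have A_sub: "complex_subalgebra A (carrier A)"
    unfolding complex_subalgebra_def using A.carrier_is_subring
    by (auto simp: complex_field_def intro!: A.smult_closed)
  have True_sub: "?S True \<subseteq> \<iota> ` carrier B"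
    by (rule generated_subalgebra_subset[OF B_sub]) (use assms in auto)
  have False_sub: "?S False \<subseteq> carrier A"
    by (rule generated_subalgebra_subset[OF A_sub]) (use assms in auto)
  have zero: "y = \<zero>\<^bsub>A\<^esub>" if "y \<in> ?S True" "E y = \<zero>\<^bsub>B\<^esub>" for y
    using True_sub that E_embed by auto
  have closed: "y \<in> carrier A" if "y \<in> ?S s" for y s
    using True_sub False_sub that by (cases s) auto
  have prod_zero: "foldr (\<otimes>\<^bsub>A\<^esub>) ys \<one>\<^bsub>A\<^esub> = \<zero>\<^bsub>A\<^esub>"
    if "\<zero>\<^bsub>A\<^esub> \<in> set ys" "set ys \<subseteq> carrier A" for ys
  proof -
    have cl: "foldr (\<otimes>\<^bsub>A\<^esub>) zs \<one>\<^bsub>A\<^esub> \<in> carrier A" if "set zs \<subseteq> carrier A" for zs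
      using that by (induction zs) auto
    show ?thesis using that by (induction ys) (auto simp: cl)
  qed
  have "E (foldr (\<otimes>\<^bsub>A\<^esub>) (map snd ps) \<one>\<^bsub>A\<^esub>) = \<zero>\<^bsub>B\<^esub>"
    if ps: "ps \<noteq> []" "distinct_adj (map fst ps)" "\<forall>(s, y)\<in>set ps. y \<in> ?S s \<and> E y = \<zero>\<^bsub>B\<^esub>" for ps
  proof (cases "\<exists>y. (True, y) \<in> set ps")
    case True
    then obtain y where y: "(True, y) \<in> set ps" by blast
    then have "y = \<zero>\<^bsub>A\<^esub>" using zero ps(3) by blast
    with y have "\<zero>\<^bsub>A\<^esub> \<in> set (map snd ps)" by force
    moreover have "set (map snd ps) \<subseteq> carrier A" using ps(3) closed by auto
    ultimately have "foldr (\<otimes>\<^bsub>A\<^esub>) (map snd ps) \<one>\<^bsub>A\<^esub> = \<zero>\<^bsub>A\<^esub>" by (rule prod_zero)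
    then show ?thesis
      using E_embed[OF B.zero_closed] by simp
  next
    case False
    then have all: "\<not> fst p" if "p \<in> set ps" for p
      using that by (metis (full_types) prod.collapse)
    obtain s y qs where q: "ps = (s, y) # qs" using ps(1) by (cases ps) auto
    have "qs = []"
    proof (cases qs)
      case (Cons p qs')
      then have "\<not> s" "\<not> fst p" using all[of "(s, y)"] all[of p] q by simp_all
      then show ?thesis using ps(2) unfolding q Cons by simp
    qed
    then show ?thesis using ps(3) closed[of y s] unfolding q by simp
  qed
  then show ?thesis
    unfolding free_pair_def free_elements_def free_subalgebras_def by simp
qed


section \<open>The copies of one factor inside the set of words\<close>

text \<open>The decomposition \<open>u = v w\<close> relative to \<open>j\<close>; a word that does not begin with a letter of \<open>\<V>\<^sub>j\<close>
  has the root as its \<open>v\<close>.\<close>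

definition split_word :: "(nat \<Rightarrow> 'v) \<Rightarrow> nat \<Rightarrow> 'v word \<Rightarrow> 'v \<times> 'v word" where
  "split_word es j u = (if u \<noteq> [] \<and> fst (hd u) = j then (snd (hd u), tl u) else (es j, u))"

locale rooted_family =
  fixes n :: nat and K :: "nat set" and Gs :: "nat \<Rightarrow> ('v, 'e) pre_digraph" and es :: "nat \<Rightarrow> 'v"
  assumes finite_K: "finite K"
    and finite_verts: "j \<in> {1..n} \<Longrightarrow> finite (verts (Gs j))"
    and root_in: "j \<in> {1..n} \<Longrightarrow> es j \<in> verts (Gs j)"
begin

abbreviation V :: "(nat \<times> 'v word) set" where "V \<equiv> K \<times> words n Gs es"

lemma split_word_words:
  assumes "j \<in> {1..n}" "u \<in> words n Gs es" "split_word es j u = (v, w)"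
  shows "v \<in> verts (Gs j)" "w \<in> words n Gs es" "w = [] \<or> fst (hd w) \<noteq> j" "prepend es j v w = u"
proof -
  show "v \<in> verts (Gs j)" "w \<in> words n Gs es"
    using assms root_in by (cases u; force simp: split_word_def words_def distinct_adj_Cons split: if_splits)+
  show "w = [] \<or> fst (hd w) \<noteq> j"
    using assms by (cases u; cases "tl u") (auto simp: split_word_def words_def split: if_splits)
  show "prepend es j v w = u"
    using assms by (cases u) (auto simp: split_word_def words_def prepend_def split: if_splits)
qed

lemma prepend_words:
  assumes "j \<in> {1..n}" "w \<in> words n Gs es" "w = [] \<or> fst (hd w) \<noteq> j" "v \<in> verts (Gs j)"
  shows "prepend es j v w \<in> words n Gs es" "split_word es j (prepend es j v w) = (v, w)"
proof -
  show "prepend es j v w \<in> words n Gs es"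
    using assms by (cases w) (auto simp: prepend_def words_def)
  show "split_word es j (prepend es j v w) = (v, w)"
    using assms by (auto simp: prepend_def split_word_def)
qed

lemma Nil_words: "[] \<in> words n Gs es"
  by (simp add: words_def)

sublocale coeff: block_decomposition "K" V fst snd Pair
  by unfold_locales (auto simp: finite_K)

text \<open>Each word \<open>w\<close> that does not begin with a letter of \<open>\<V>\<^sub>j\<close> is the root of a copy of \<open>\<V>\<^sub>j\<close>, and these
  copies partition the set of words.\<close>

lemma factor_decomposition:
  assumes j: "j \<in> {1..n}"
  shows "block_decomposition (K \<times> verts (Gs j)) V
    (\<lambda>(l, u). (l, fst (split_word es j u))) (\<lambda>(l, u). snd (split_word es j u))
    (\<lambda>(l, v) w. (l, prepend es j v w))"
proof
  show "finite (K \<times> verts (Gs j))" using finite_verts[OF j] finite_K by simp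
qed (auto simp: split_word_words[OF j _ prod.collapse[symmetric]]
      prepend_words[OF j split_word_words(2,3)[OF j _ prod.collapse[symmetric]]])

definition factor_op :: "nat \<Rightarrow> (nat \<times> 'v) cmat \<Rightarrow> (nat \<times> 'v word) operator" where
  "factor_op j = block_decomposition.amplify (K \<times> verts (Gs j)) V
    (\<lambda>(l, u). (l, fst (split_word es j u))) (\<lambda>(l, u). snd (split_word es j u))
    (\<lambda>(l, v) w. (l, prepend es j v w))"

lemmas factor_op_closed = block_decomposition.amplify_closed[OF factor_decomposition, folded factor_op_def]
lemmas factor_op_hom = block_decomposition.amplify_hom[OF factor_decomposition, folded factor_op_def]
lemmas complex_subalgebra_factor_op =
  block_decomposition.complex_subalgebra_amplify[OF factor_decomposition, folded factor_op_def]

lemma factor_op_apply: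
  assumes "j \<in> {1..n}" "l \<in> K" "w \<in> words n Gs es" "w = [] \<or> fst (hd w) \<noteq> j" "v \<in> verts (Gs j)"
  shows "factor_op j Y \<xi> (l, prepend es j v w)
    = (\<Sum>l'\<in>K. \<Sum>v'\<in>verts (Gs j). Y (l, v) (l', v') * \<xi> (l', prepend es j v' w))"
  using assms(2)
  unfolding factor_op_def block_decomposition.amplify_def[OF factor_decomposition[OF assms(1)]]
  by (simp add: prepend_words[OF assms(1,3,4,5)] sum.cartesian_product case_prod_unfold)

text \<open>The subalgebras \<open>factor_op j ` \<dots>\<close> share one copy of \<open>M\<^sub>k(\<complex>)\<close>: acting by \<open>\<beta> \<otimes> 1\<close> on each copy of
  \<open>[k] \<times> \<V>\<^sub>j\<close> leaves the word alone, so it does not depend on \<open>j\<close>.\<close>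

lemma factor_op_embed:
  assumes j: "j \<in> {1..n}"
  shows "factor_op j (tensor_embed (verts (Gs j)) \<beta>) = coeff.amplify \<beta>"
proof (intro ext, clarify)
  fix \<xi> l u
  show "factor_op j (tensor_embed (verts (Gs j)) \<beta>) \<xi> (l, u) = coeff.amplify \<beta> \<xi> (l, u)"
  proof (cases "(l, u) \<in> V")
    case True
    obtain v w where vw: "split_word es j u = (v, w)" by fastforce
    note d = split_word_words[OF j _ vw]
    have "factor_op j (tensor_embed (verts (Gs j)) \<beta>) \<xi> (l, u) =
      (\<Sum>l'\<in>K. \<Sum>v'\<in>verts (Gs j). (if v = v' then \<beta> l l' else 0) * \<xi> (l', prepend es j v' w))"
      using factor_op_apply[OF j, of l w v] True d
      by (simp add: tensor_embed_def tensor_def mat_alg_def)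
        (intro sum.cong refl, auto)
    also have "\<dots> = (\<Sum>l'\<in>K. \<beta> l l' * \<xi> (l', u))"
      using d True finite_verts[OF j] by (simp add: finite_K if_distrib[of "\<lambda>t. t * _"] cong: if_cong)
    finally show ?thesis using True by (simp add: coeff.amplify_def)
  next
    case False
    then show ?thesis
      by (simp only: factor_op_def coeff.amplify_def if_False
          block_decomposition.amplify_def[OF factor_decomposition[OF j]])
  qed
qed


section \<open>The conditional expectation\<close>

definition vacuum :: "(nat \<times> 'v word) operator \<Rightarrow> nat cmat" where
  "vacuum S = (\<lambda>i j. S (delta (j, [])) (i, []))"

text \<open>An operator in the algebra sees only \<open>V\<close>, so its compression is automatically a matrix over \<open>K\<close>.\<close>

lemma vacuum_outside:
  assumes "S \<in> carrier (op_alg V)" "i \<notin> K \<or> j \<notin> K"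
  shows "vacuum S i j = 0"
proof (cases "i \<in> K")
  case True
  then have "cut V (delta (j, [])) = (\<lambda>u. 0)" using assms(2) by (auto simp: cut_def delta_def)
  then have "S (delta (j, [])) = (\<lambda>u. 0)"
    using op_algD(3)[OF assms(1), of "delta (j, [])"] op_alg_zero[OF assms(1)] by simp
  then show ?thesis by (simp add: vacuum_def)
qed (simp add: vacuum_def op_algD(5)[OF assms(1)])

lemma coeff_delta:
  assumes "\<beta> \<in> carrier (mat_alg K)"
  shows "coeff.amplify \<beta> (delta (j, [])) = (\<lambda>u. \<Sum>l\<in>K. \<beta> l j * delta (l, []) u)"
proof (intro ext, clarify)
  fix l :: nat and w :: "'v word"
  have z: "\<beta> x y = 0" if "\<not> (x \<in> K \<and> y \<in> K)" for x y
    using assms that by (auto simp: mat_alg_def)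
  have "coeff.amplify \<beta> (delta (j, [])) (l, w) = (if w = [] then \<beta> l j else 0)"
    using z[of l j] Nil_words
    by (auto simp: coeff.amplify_def delta_def finite_K if_distrib[of "\<lambda>t. _ * t"] cong: if_cong conj_cong)
  also have "\<dots> = (\<Sum>l'\<in>K. \<beta> l' j * delta (l', []) (l, w))"
    using z[of l j] by (auto simp: delta_def finite_K if_distrib[of "\<lambda>t. _ * t"] cong: if_cong conj_cong)
  finally show "coeff.amplify \<beta> (delta (j, [])) (l, w) = (\<Sum>l'\<in>K. \<beta> l' j * delta (l', []) (l, w))" .
qed

text \<open>The vertices \<open>(l, [])\<close> lie in the copy of \<open>K \<times> \<V>\<^sub>j\<close> rooted at the empty word, where they are the
  points \<open>(l, es j)\<close>. Compressing there to these points is \<open>Id \<otimes> \<phi>\<^sub>j\<close>.\<close>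

lemma vacuum_factor_op:
  assumes j: "j \<in> {1..n}" and Y: "Y \<in> carrier (mat_alg (K \<times> verts (Gs j)))"
  shows "vacuum (factor_op j Y) = tensor_expectation (es j) Y"
proof (intro ext)
  fix i i'
  show "vacuum (factor_op j Y) i i' = tensor_expectation (es j) Y i i'"
  proof (cases "i \<in> K \<and> i' \<in> K")
    case True
    have "vacuum (factor_op j Y) i i' = (\<Sum>l'\<in>K. \<Sum>v'\<in>verts (Gs j).
        Y (i, es j) (l', v') * delta (i', []) (l', prepend es j v' []))"
      using factor_op_apply[OF j, of i "[]" "es j"] True root_in[OF j] Nil_words
      by (simp add: vacuum_def prepend_def)
    also have "\<dots> = (\<Sum>l'\<in>K. \<Sum>v'\<in>verts (Gs j). if v' = es j then if l' = i' then Y (i, es j) (l', v') else 0 else 0)"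
      by (intro sum.cong) (auto simp: delta_def prepend_def)
    also have "\<dots> = Y (i, es j) (i', es j)"
      using True root_in[OF j] finite_verts[OF j] finite_K by simp
    finally show ?thesis by (simp add: tensor_expectation_def root_functional_def)
  next
    case False
    then have "Y (i, es j) (i', es j) = 0" using Y by (auto simp: mat_alg_def)
    then show ?thesis using False vacuum_outside[OF factor_op_closed[OF j]]
      by (auto simp: tensor_expectation_def root_functional_def)
  qed
qed

lemma ov_prob_space_vacuum: "ov_prob_space (op_alg V) (mat_alg K) coeff.amplify vacuum"
proof -
  interpret A: complex_algebra "op_alg V" by (rule complex_algebra_op_alg)
  interpret B: complex_algebra "mat_alg K" by (rule complex_algebra_mat_alg[OF finite_K])
  show ?thesis
  proof unfold_locales
    fix x assume x: "x \<in> carrier (op_alg V)"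
    show "vacuum x \<in> carrier (mat_alg K)"
      using vacuum_outside[OF x] by (auto simp: mat_alg_def)
  next
    fix \<beta> assume \<beta>: "\<beta> \<in> carrier (mat_alg K)"
    then have z: "\<beta> x y = 0" if "x \<notin> K" for x y
      using that by (auto simp: mat_alg_def)
    show "vacuum (coeff.amplify \<beta>) = \<beta>"
      using z by (intro ext, simp add: vacuum_def coeff_delta[OF \<beta>])
        (auto simp: delta_def finite_K if_distrib[of "\<lambda>t. _ * t"] cong: if_cong)
  next
    fix \<beta>\<^sub>1 x \<beta>\<^sub>2
    assume \<beta>: "\<beta>\<^sub>1 \<in> carrier (mat_alg K)" "\<beta>\<^sub>2 \<in> carrier (mat_alg K)"
      and x: "x \<in> carrier (op_alg V)"
    have z: "\<beta>\<^sub>1 i l = 0" if "i \<notin> K" for i l using \<beta>(1) that by (auto simp: mat_alg_def)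
    have "vacuum (coeff.amplify \<beta>\<^sub>1 \<otimes>\<^bsub>op_alg V\<^esub> x \<otimes>\<^bsub>op_alg V\<^esub> coeff.amplify \<beta>\<^sub>2) i j
       = (\<beta>\<^sub>1 \<otimes>\<^bsub>mat_alg K\<^esub> vacuum x \<otimes>\<^bsub>mat_alg K\<^esub> \<beta>\<^sub>2) i j" for i j
    proof (cases "i \<in> K")
      case True
      have "vacuum (coeff.amplify \<beta>\<^sub>1 \<otimes>\<^bsub>op_alg V\<^esub> x \<otimes>\<^bsub>op_alg V\<^esub> coeff.amplify \<beta>\<^sub>2) i j
        = (\<Sum>l\<in>K. \<beta>\<^sub>1 i l * (\<Sum>l'\<in>K. \<beta>\<^sub>2 l' j * x (delta (l', [])) (l, [])))"
        using True Nil_words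
        by (simp add: vacuum_def op_alg_simps coeff_delta[OF \<beta>(2)] op_alg_sum[OF x])
          (simp add: coeff.amplify_def)
      also have "\<dots> = (\<Sum>l\<in>K. \<Sum>l'\<in>K. \<beta>\<^sub>1 i l * vacuum x l l' * \<beta>\<^sub>2 l' j)"
        by (simp add: vacuum_def sum_distrib_left mult_ac)
      also have "\<dots> = (\<Sum>l'\<in>K. \<Sum>l\<in>K. \<beta>\<^sub>1 i l * vacuum x l l' * \<beta>\<^sub>2 l' j)"
        by (rule sum.swap)
      finally show ?thesis by (simp add: mat_alg_def sum_distrib_right)
    next
      case False
      then show ?thesis by (auto simp: vacuum_def op_alg_simps coeff.amplify_def mat_alg_def z)
    qed
    then show "vacuum (coeff.amplify \<beta>\<^sub>1 \<otimes>\<^bsub>op_alg V\<^esub> x \<otimes>\<^bsub>op_alg V\<^esub> coeff.amplify \<beta>\<^sub>2)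
       = \<beta>\<^sub>1 \<otimes>\<^bsub>mat_alg K\<^esub> vacuum x \<otimes>\<^bsub>mat_alg K\<^esub> \<beta>\<^sub>2"
      by (intro ext)
  qed (simp_all add: coeff.amplify_hom coeff.amplify_smult, simp_all add: vacuum_def op_alg_simps mat_alg_def)
qed


section \<open>Freeness of the factors\<close>

text \<open>The support statement is stronger than what freeness needs, so that it can be proved by induction
  on the number of factors: it records that the word produced by the remaining factors does not
  begin with a letter of \<open>\<V>\<^sub>j\<close>, which makes the next factor act on the root of a copy of \<open>\<V>\<^sub>j\<close>.\<close>

lemma alternating_product_support:
  assumes "distinct_adj (map fst ps)"
    and "\<And>j x. (j, x) \<in> set ps \<Longrightarrow> j \<in> {1..n} \<and>
       x \<in> factor_op j ` carrier (mat_alg (K \<times> verts (Gs j))) \<and> vacuum x = (\<lambda>_ _. 0)"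
    and "foldr (\<otimes>\<^bsub>op_alg V\<^esub>) (map snd ps) \<one>\<^bsub>op_alg V\<^esub> (delta (i, [])) (l, u) \<noteq> 0"
  shows "map fst u = map fst ps"
  using assms
proof (induction ps arbitrary: l u)
  case Nil
  then show ?case by (auto simp: op_alg_simps cut_def delta_def split: if_splits)
next
  case (Cons p ps)
  obtain j x where p: "p = (j, x)" by fastforce
  have j: "j \<in> {1..n}" and vac: "vacuum x = (\<lambda>_ _. 0)" using Cons.prems(2)[of j x] p by auto
  obtain Y where Y: "Y \<in> carrier (mat_alg (K \<times> verts (Gs j)))" "x = factor_op j Y"
    using Cons.prems(2)[of j x] p by auto
  define \<xi> where "\<xi> = foldr (\<otimes>\<^bsub>op_alg V\<^esub>) (map snd ps) \<one>\<^bsub>op_alg V\<^esub> (delta (i, []))"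
  have IH: "map fst w = map fst ps" if "\<xi> (l', w) \<noteq> 0" for l' w
    by (rule Cons.IH[where l = l' and u = w])
      (use Cons.prems(1,2) that in \<open>auto simp: \<xi>_def p distinct_adj_Cons\<close>)
  have nz: "factor_op j Y \<xi> (l, u) \<noteq> 0"
  proof -
    have "foldr (\<otimes>\<^bsub>op_alg V\<^esub>) (map snd (p # ps)) \<one>\<^bsub>op_alg V\<^esub> =
        factor_op j Y \<otimes>\<^bsub>op_alg V\<^esub> foldr (\<otimes>\<^bsub>op_alg V\<^esub>) (map snd ps) \<one>\<^bsub>op_alg V\<^esub>"
      by (simp add: p Y(2))
    then have "foldr (\<otimes>\<^bsub>op_alg V\<^esub>) (map snd (p # ps)) \<one>\<^bsub>op_alg V\<^esub> (delta (i, [])) = factor_op j Y \<xi>"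
      by (simp only: \<xi>_def op_alg_mult_apply[where S = "factor_op j Y"])
    then show ?thesis using Cons.prems(3) by metis
  qed
  then have in_V: "l \<in> K" "u \<in> words n Gs es"
    using op_algD(5)[OF factor_op_closed[OF j, of Y], of "(l, u)" \<xi>] by blast+
  obtain v w where vw: "split_word es j u = (v, w)" by fastforce
  note d = split_word_words[OF j in_V(2) vw]
  \<comment> \<open>The copy through \<open>u\<close> meets the support of \<open>\<xi>\<close> only at its root \<open>w\<close>.\<close>
  have no_j: "\<xi> (l', prepend es j v' w) = 0" if "v' \<noteq> es j" for l' v'
  proof (rule ccontr)
    assume "\<not> ?thesis"
    then have "map fst ps = j # map fst w"
      using IH[of l' "prepend es j v' w"] that by (simp add: prepend_def)
    then show False using Cons.prems(1) by (simp add: p)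
  qed
  have "factor_op j Y \<xi> (l, u) = (\<Sum>l'\<in>K. \<Sum>v'\<in>verts (Gs j).
      if v' = es j then Y (l, v) (l', v') * \<xi> (l', w) else 0)"
    unfolding d(4)[symmetric] factor_op_apply[OF j in_V(1) d(2,3,1)]
    by (intro sum.cong) (auto simp: no_j, auto simp: prepend_def)
  also have "\<dots> = (\<Sum>l'\<in>K. Y (l, v) (l', es j) * \<xi> (l', w))"
    using finite_verts[OF j] root_in[OF j] by simp
  finally have "(\<Sum>l'\<in>K. Y (l, v) (l', es j) * \<xi> (l', w)) \<noteq> 0"
    using nz by simp
  then obtain l' where l': "Y (l, v) (l', es j) * \<xi> (l', w) \<noteq> 0"
    by (rule sum.not_neutral_contains_not_neutral)
  \<comment> \<open>The coefficients that lead from the root of the copy back to the root are the entries of the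
    expectation, which vanish.\<close>
  have "v \<noteq> es j"
  proof
    assume "v = es j"
    then have "Y (l, v) (l', es j) = vacuum x l l'"
      using vacuum_factor_op[OF j Y(1)] Y(2)
      by (simp add: tensor_expectation_def root_functional_def)
    then show False using l' vac by simp
  qed
  then have "u = (j, v) # w" using d(4) by (simp add: prepend_def)
  moreover have "map fst w = map fst ps" using l' IH[of l' w] by simp
  ultimately show ?case by (simp add: p)
qed

text \<open>The matrices are arbitrary: freeness only uses that each generated algebra lies in the range of
  \<open>factor_op j\<close>.\<close>

lemma free_factor_op:
  assumes Y: "\<And>j. j \<in> {1..n} \<Longrightarrow> Y j \<in> carrier (mat_alg (K \<times> verts (Gs j)))"
  shows "free_elements (op_alg V) (mat_alg K) coeff.amplify vacuum {1..n}
    (\<lambda>j. factor_op j (Y j))"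
  unfolding free_elements_def free_subalgebras_def
proof (intro allI impI)
  fix ps :: "(nat \<times> (nat \<times> 'v word) operator) list"
  let ?gen = "\<lambda>j. generated_subalgebra (op_alg V)
    (insert (factor_op j (Y j)) (coeff.amplify ` carrier (mat_alg K)))"
  assume ps: "ps \<noteq> []" "distinct_adj (map fst ps)"
    "\<forall>(j, x)\<in>set ps. j \<in> {1..n} \<and> x \<in> ?gen j \<and> vacuum x = \<zero>\<^bsub>mat_alg K\<^esub>"
  have gen: "?gen j \<subseteq> factor_op j ` carrier (mat_alg (K \<times> verts (Gs j)))"
    if j: "j \<in> {1..n}" for j
  proof (rule generated_subalgebra_subset[OF complex_subalgebra_factor_op[OF j]])
    have "coeff.amplify \<beta> \<in> factor_op j ` carrier (mat_alg (K \<times> verts (Gs j)))"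
      if "\<beta> \<in> carrier (mat_alg K)" for \<beta>
    proof -
      interpret ov_prob_space "mat_alg (K \<times> verts (Gs j))" "mat_alg K"
        "tensor_embed (verts (Gs j))" "tensor_expectation (es j)"
        by (rule ov_prob_space_tensor) (simp_all add: finite_K finite_verts[OF j] root_in[OF j])
      show ?thesis
        using ring_hom_closed[OF embed_hom that] factor_op_embed[OF j, of \<beta>] by (metis imageI)
    qed
    then show "insert (factor_op j (Y j)) (coeff.amplify ` carrier (mat_alg K))
      \<subseteq> factor_op j ` carrier (mat_alg (K \<times> verts (Gs j)))"
      using Y[OF j] by auto
  qed
  have zero: "\<zero>\<^bsub>mat_alg K\<^esub> = (\<lambda>_ _. 0)" by (simp add: mat_alg_def)
  have "j \<in> {1..n} \<and> x \<in> factor_op j ` carrier (mat_alg (K \<times> verts (Gs j))) \<and>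
      vacuum x = (\<lambda>_ _. 0)" if "(j, x) \<in> set ps" for j x
    using ps(3) that gen[of j] zero by fastforce
  then have "foldr (\<otimes>\<^bsub>op_alg V\<^esub>) (map snd ps) \<one>\<^bsub>op_alg V\<^esub> (delta (i', [])) (i, []) = 0" for i i'
    using alternating_product_support[OF ps(2), where u = "[]" and i = i' and l = i] ps(1) by fastforce
  then show "vacuum (foldr (\<otimes>\<^bsub>op_alg V\<^esub>) (map snd ps) \<one>\<^bsub>op_alg V\<^esub>) = \<zero>\<^bsub>mat_alg K\<^esub>"
    by (simp add: zero vacuum_def)
qed

end


section \<open>Path counting\<close>

lemma entry_eq: "x \<in> V \<Longrightarrow> entry V S x y = S (delta y) x"
proof -
  assume "x \<in> V"
  then have "entry V S x y = (\<Sum>\<^sub>\<infinity>u\<in>{x}. cnj (delta x u) * S (delta y) u)"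
    unfolding entry_def l2_inner_def
    by (intro infsum_cong_neutral) (auto simp: delta_def)
  then show ?thesis by (simp add: delta_def)
qed

text \<open>Matrix entries merge parallel edges; summing over the second index restores the sum over edges.\<close>

lemma relator_color_mat_sum:
  fixes G :: "('v, 'e) pre_digraph"
  assumes "fin_digraph G" "l \<in> verts G"
  shows "(\<Sum>l'\<in>verts G. relator_color_mat G c a \<alpha> l l' * h l')
    = (\<Sum>f\<in>out_arcs G l. if c f = \<alpha> then complex_of_real (a f) * h (head G f) else 0)"
proof -
  interpret fin_digraph G by fact
  have out: "finite (out_arcs G l)" by (simp add: out_arcs_def)
  have arcs: "out_arcs (color_subgraph G c \<alpha>) l = {f \<in> out_arcs G l. c f = \<alpha>}"
    "head (color_subgraph G c \<alpha>) = head G"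
    by (auto simp: color_subgraph_def out_arcs_def)
  have "relator_color_mat G c a \<alpha> l l'
      = (\<Sum>f\<in>out_arcs G l. if c f = \<alpha> \<and> l' = head G f then complex_of_real (a f) else 0)"
    if "l' \<in> verts G" for l'
  proof -
    have "relator_color_mat G c a \<alpha> l l'
        = (\<Sum>f\<in>{f \<in> out_arcs G l. c f = \<alpha>}. complex_of_real (a f) * delta l' (head G f))"
      using assms(2) that unfolding relator_color_mat_def op_mat_def
      by (simp only: entry_eq jacobi_def arcs) simp
    also have "\<dots> = (\<Sum>f\<in>out_arcs G l. if c f = \<alpha> \<and> l' = head G f then complex_of_real (a f) else 0)"
      unfolding sum.inter_filter[OF out] by (intro sum.cong) (auto simp: delta_def)
    finally show ?thesis .
  qed
  then have "(\<Sum>l'\<in>verts G. relator_color_mat G c a \<alpha> l l' * h l')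
      = (\<Sum>l'\<in>verts G. \<Sum>f\<in>out_arcs G l.
          if l' = head G f then (if c f = \<alpha> then complex_of_real (a f) * h l' else 0) else 0)"
    by (auto simp: sum_distrib_right intro!: sum.cong)
  also have "\<dots> = (\<Sum>f\<in>out_arcs G l. \<Sum>l'\<in>verts G.
          if l' = head G f then (if c f = \<alpha> then complex_of_real (a f) * h l' else 0) else 0)"
    by (rule sum.swap)
  also have "\<dots> = (\<Sum>f\<in>out_arcs G l. if c f = \<alpha> then complex_of_real (a f) * h (head G f) else 0)"
    by (intro sum.cong refl) (auto simp: finite_verts)
  finally show ?thesis .
qed

text \<open>Both matrices attached to a color are thus covered by the same lemmas.\<close>

lemma color_adjacency_mat_eq: "color_adjacency_mat G c = relator_color_mat G c (\<lambda>_. 1)"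
  by (simp add: color_adjacency_mat_def relator_color_mat_def adjacency_def fun_eq_iff)

lemma relator_color_mat_closed: "relator_color_mat G c a \<alpha> \<in> carrier (mat_alg (verts G))"
  by (auto simp: relator_color_mat_def op_mat_def mat_alg_def split: if_splits)

lemma tensor_closed:
  "X \<in> carrier (mat_alg I) \<Longrightarrow> M \<in> carrier (mat_alg J) \<Longrightarrow> tensor X M \<in> carrier (mat_alg (I \<times> J))"
  by (auto simp: mat_alg_def tensor_def)

definition color_sum_mat where
  "color_sum_mat G c a H c' C = (\<Oplus>\<^bsub>mat_alg (verts G \<times> verts H)\<^esub>\<alpha>\<in>C.
      tensor (relator_color_mat G c a \<alpha>) (color_adjacency_mat H c' \<alpha>))"

lemma color_sum_mat_closed:
  assumes "finite (verts G)" "finite (verts H)"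
  shows "color_sum_mat G c a H c' C \<in> carrier (mat_alg (verts G \<times> verts H))"
proof -
  interpret complex_algebra "mat_alg (verts G \<times> verts H)"
    by (rule complex_algebra_mat_alg) (use assms in simp)
  show ?thesis
    unfolding color_sum_mat_def color_adjacency_mat_eq
    by (intro finsum_closed) (auto intro!: tensor_closed relator_color_mat_closed)
qed

text \<open>The operator \<open>\<Sum>\<^sub>\<alpha> X\<^sub>\<alpha> \<otimes> A\<^sub>\<alpha>\<close> sums over pairs of edges of equal color: a pair contributes to the
  summand of \<open>\<alpha>\<close> exactly if \<open>\<alpha>\<close> is the color of both of its edges. As the color of an edge of \<open>H\<close> lies in \<open>C\<close>,
  each such pair is met exactly once.\<close>

lemma color_sum_mat_sum:
  assumes G: "fin_digraph G" and H: "fin_digraph H" and C: "finite C"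
    and c': "\<And>g. g \<in> arcs H \<Longrightarrow> c' g \<in> C"
    and l: "l \<in> verts G" and v: "v \<in> verts H"
  shows "(\<Sum>l'\<in>verts G. \<Sum>v'\<in>verts H. color_sum_mat G c a H c' C (l, v) (l', v') * \<eta> l' v')
    = (\<Sum>f\<in>out_arcs G l. \<Sum>g\<in>out_arcs H v.
        if c f = c' g then complex_of_real (a f) * \<eta> (head G f) (head H g) else 0)"
proof -
  let ?X = "relator_color_mat G c a" and ?A = "relator_color_mat H c' (\<lambda>_. 1)"
  have fin: "finite (verts G \<times> verts H)"
    using G H by (simp add: fin_digraph_def fin_digraph_axioms_def)
  have "color_sum_mat G c a H c' C (l, v) (l', v') = (\<Sum>\<alpha>\<in>C. ?X \<alpha> l l' * ?A \<alpha> v v')" for l' v'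
    unfolding color_sum_mat_def color_adjacency_mat_eq
    by (subst finsum_mat_alg[OF fin C])
      (intro tensor_closed relator_color_mat_closed, simp add: tensor_def)
  then have "(\<Sum>l'\<in>verts G. \<Sum>v'\<in>verts H. color_sum_mat G c a H c' C (l, v) (l', v') * \<eta> l' v')
    = (\<Sum>l'\<in>verts G. \<Sum>v'\<in>verts H. \<Sum>\<alpha>\<in>C. ?X \<alpha> l l' * (?A \<alpha> v v' * \<eta> l' v'))"
    by (simp add: sum_distrib_right mult.assoc)
  also have "\<dots> = (\<Sum>\<alpha>\<in>C. \<Sum>l'\<in>verts G. ?X \<alpha> l l' * (\<Sum>v'\<in>verts H. ?A \<alpha> v v' * \<eta> l' v'))"
    by (simp add: sum_distrib_left sum.swap[of _ _ C])
  also have "\<dots> = (\<Sum>\<alpha>\<in>C. \<Sum>f\<in>out_arcs G l. \<Sum>g\<in>out_arcs H v.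
      if c f = \<alpha> then if c' g = \<alpha> then complex_of_real (a f) * \<eta> (head G f) (head H g) else 0 else 0)"
    unfolding relator_color_mat_sum[OF G l] relator_color_mat_sum[OF H v]
    by (intro sum.cong refl) (auto simp: sum_distrib_left intro!: sum.cong)
  also have "\<dots> = (\<Sum>f\<in>out_arcs G l. \<Sum>g\<in>out_arcs H v. \<Sum>\<alpha>\<in>C.
      if c f = \<alpha> then if c' g = \<alpha> then complex_of_real (a f) * \<eta> (head G f) (head H g) else 0 else 0)"
    by (simp only: sum.swap[of _ _ C])
  also have "\<dots> = (\<Sum>f\<in>out_arcs G l. \<Sum>g\<in>out_arcs H v.
        if c f = c' g then complex_of_real (a f) * \<eta> (head G f) (head H g) else 0)"
  proof (intro sum.cong refl)
    fix f g assume "g \<in> out_arcs H v"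
    then have "c' g \<in> C" using c' by simp
    then show "(\<Sum>\<alpha>\<in>C. if c f = \<alpha> then if c' g = \<alpha> then complex_of_real (a f) * \<eta> (head G f) (head H g) else 0 else 0)
      = (if c f = c' g then complex_of_real (a f) * \<eta> (head G f) (head H g) else 0)"
      using C by (cases "c f = c' g") (simp cong: if_cong, auto intro!: sum.neutral)
  qed
  finally show ?thesis .
qed

text \<open>An arc \<open>(f, (j, g), w)\<close> leaving \<open>(l, u)\<close> satisfies \<open>u = prepend es j (tail g) w\<close> with \<open>w\<close> not
  beginning with a letter of \<open>\<V>\<^sub>j\<close>. Uniqueness of the decomposition determines \<open>w\<close> and \<open>tail g\<close> from \<open>j\<close>,
  so the arc amounts to the triple \<open>(j, f, g)\<close>.\<close>

lemma (in rooted_family) afp_jacobi_eq: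
  fixes G :: "(nat, 'f) pre_digraph"
  assumes G: "fin_digraph G" and K: "verts G = K"
    and H: "\<And>j. j \<in> {1..n} \<Longrightarrow> fin_digraph (Gs j)"
    and u: "l \<in> K" "u \<in> words n Gs es"
  shows "afp_jacobi n G c Gs es cs a b \<xi> (l, u) = complex_of_real (b l) * \<xi> (l, u) +
    (\<Sum>j\<in>{1..n}. \<Sum>f\<in>out_arcs G l. \<Sum>g\<in>out_arcs (Gs j) (fst (split_word es j u)).
       if c f = cs j g then complex_of_real (a f) *
         \<xi> (head G f, prepend es j (head (Gs j) g) (snd (split_word es j u))) else 0)"
proof -
  let ?v = "\<lambda>j. fst (split_word es j u)" and ?w = "\<lambda>j. snd (split_word es j u)"
  let ?F = "\<lambda>j f g. complex_of_real (a f) * \<xi> (head G f, prepend es j (head (Gs j) g) (?w j))"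
  let ?\<Gamma> = "afp_graph n G c Gs es cs"
  let ?S = "SIGMA j:{1..n}. {(f, g) \<in> out_arcs G l \<times> out_arcs (Gs j) (?v j). c f = cs j g}"
  let ?i = "\<lambda>(j, f, g). (f, (j, g), ?w j)" and ?j = "\<lambda>(f, (j, g), w). (j, f, g)"
  let ?h = "\<lambda>(j, f, g). ?F j f g"
  have finG: "finite (out_arcs G l)"
    using G by (simp add: fin_digraph_def fin_digraph_axioms_def out_arcs_def)
  have finH: "finite (out_arcs (Gs j) v)" if "j \<in> {1..n}" for j v
    using H[OF that] by (simp add: fin_digraph_def fin_digraph_axioms_def out_arcs_def)
  have d: "?v j \<in> verts (Gs j)" "?w j \<in> words n Gs es" "?w j = [] \<or> fst (hd (?w j)) \<noteq> j"
      "prepend es j (?v j) (?w j) = u" if "j \<in> {1..n}" for j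
    using split_word_words[OF that u(2), of "?v j" "?w j"] by simp_all
  have "(\<Sum>e\<in>out_arcs ?\<Gamma> (l, u). complex_of_real ((\<lambda>(f, _, _). a f) e) * \<xi> (head ?\<Gamma> e))
      = (\<Sum>(j, f, g)\<in>?S. ?F j f g)"
  proof (rule sum.reindex_bij_witness[where i = ?i and j = ?j])
    fix e assume e: "e \<in> out_arcs ?\<Gamma> (l, u)"
    obtain f j g w where e_eq: "e = (f, (j, g), w)" by (cases e) auto
    have *: "f \<in> out_arcs G l" "j \<in> {1..n}" "g \<in> arcs (Gs j)" "c f = cs j g" "w \<in> words n Gs es"
      "prepend es j (tail (Gs j) g) w = u" "w = [] \<or> fst (hd w) \<noteq> j"
      using e by (auto simp: e_eq out_arcs_def afp_graph_def afp_arcs_def)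
    have "tail (Gs j) g \<in> verts (Gs j)"
      using H[OF *(2)] *(3) by (simp add: fin_digraph_def wf_digraph_def)
    then have split: "split_word es j u = (tail (Gs j) g, w)"
      using prepend_words(2)[OF *(2,5,7), of "tail (Gs j) g"] *(6) by simp
    show "?i (?j e) = e"
      by (simp add: e_eq split)
    show "?j e \<in> ?S"
      using * by (simp add: e_eq split)
    show "?h (?j e)
        = complex_of_real ((\<lambda>(f, _, _). a f) e) * \<xi> (head ?\<Gamma> e)"
      by (simp add: e_eq split afp_graph_def)
  next
    fix t assume t: "t \<in> ?S"
    obtain j f g where t_eq: "t = (j, f, g)" by (cases t) auto
    have *: "j \<in> {1..n}" "f \<in> arcs G" "tail G f = l" "g \<in> arcs (Gs j)" "tail (Gs j) g = ?v j" "c f = cs j g"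
      using t by (auto simp: t_eq out_arcs_def)
    have "head (Gs j) g \<in> verts (Gs j)"
      using H[OF *(1)] *(4) by (simp add: fin_digraph_def wf_digraph_def)
    then have "prepend es j (head (Gs j) g) (?w j) \<in> words n Gs es"
      using prepend_words(1)[OF *(1) d(2,3)[OF *(1)]] by simp
    then show "?i t \<in> out_arcs ?\<Gamma> (l, u)"
      using * d[OF *(1)] u(2) unfolding out_arcs_def afp_graph_def afp_arcs_def t_eq
      by simp
    show "?j (?i t) = t"
      by (simp add: t_eq)
  qed
  also have "\<dots> = (\<Sum>j\<in>{1..n}. \<Sum>(f, g)\<in>{(f, g) \<in> out_arcs G l \<times> out_arcs (Gs j) (?v j). c f = cs j g}.
      ?F j f g)"
    by (rule sum.Sigma[symmetric]) (auto intro: finite_subset[OF _ finite_cartesian_product[OF finG finH]])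
  also have "\<dots> = (\<Sum>j\<in>{1..n}. \<Sum>f\<in>out_arcs G l. \<Sum>g\<in>out_arcs (Gs j) (?v j). if c f = cs j g then ?F j f g else 0)"
  proof (rule sum.cong[OF refl])
    fix j assume j: "j \<in> {1..n}"
    have "(\<Sum>(f, g)\<in>{(f, g) \<in> out_arcs G l \<times> out_arcs (Gs j) (?v j). c f = cs j g}. ?F j f g)
      = (\<Sum>(f, g)\<in>out_arcs G l \<times> out_arcs (Gs j) (?v j). if c f = cs j g then ?F j f g else 0)"
      by (rule sum.mono_neutral_cong_left) (auto simp: finG finH[OF j] split: if_splits)
    then show "(\<Sum>(f, g)\<in>{(f, g) \<in> out_arcs G l \<times> out_arcs (Gs j) (?v j). c f = cs j g}. ?F j f g)
      = (\<Sum>f\<in>out_arcs G l. \<Sum>g\<in>out_arcs (Gs j) (?v j). if c f = cs j g then ?F j f g else 0)"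
      by (simp add: sum.cartesian_product)
  qed
  finally show ?thesis by (simp add: afp_jacobi_def jacobi_def)
qed

text \<open>The operator \<open>J\<close> is defined on functions on the whole type and is not supported on \<open>V\<close>, yet its powers
  can be computed inside the algebra, because \<open>S\<close> ignores what happens outside \<open>V\<close>.\<close>

lemma op_alg_pow:
  assumes S: "S \<in> carrier (op_alg V)" and J: "\<And>\<xi>. S \<xi> = cut V (J \<xi>)"
  shows "(S [^]\<^bsub>op_alg V\<^esub> (p::nat)) \<xi> = cut V ((J ^^ p) \<xi>)"
proof -
  interpret complex_algebra "op_alg V" by (rule complex_algebra_op_alg)
  show ?thesis
  proof (induction p)
    case (Suc p)
    have "(S [^]\<^bsub>op_alg V\<^esub> Suc p) \<xi> = S ((S [^]\<^bsub>op_alg V\<^esub> p) \<xi>)"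
      using nat_pow_Suc2[OF S, of p] by (simp only: op_alg_mult_apply)
    also have "\<dots> = S ((J ^^ p) \<xi>)" by (simp add: Suc.IH op_algD(3)[OF S])
    also have "\<dots> = cut V ((J ^^ Suc p) \<xi>)" by (simp add: J)
    finally show ?case .
  qed (simp add: op_alg_simps)
qed


section \<open>Realization of the free product by free operators\<close>

theorem theorem5p8:
  fixes n k :: nat
    and Gs :: "nat \<Rightarrow> ('v, 'e) pre_digraph" and revs :: "nat \<Rightarrow> 'e \<Rightarrow> 'e"
    and es :: "nat \<Rightarrow> 'v" and cs :: "nat \<Rightarrow> 'e \<Rightarrow> 'c" and Cs :: "nat \<Rightarrow> 'c set"
    and G :: "(nat, 'f) pre_digraph" and rev :: "'f \<Rightarrow> 'f" and c :: "'f \<Rightarrow> 'c"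
    and a :: "'f \<Rightarrow> real" and b :: "nat \<Rightarrow> real"
  assumes graphs: "\<And>i. i \<in> {1..n} \<Longrightarrow>
      finite_rooted_colored_graph (Gs i) (revs i) (cs i) (Cs i) (es i)"
    and colors_finite: "\<And>i. i \<in> {1..n} \<Longrightarrow> finite (Cs i)"
    and colors_disjoint: "disjoint_family_on Cs {1..n}"
    and relator: "finite_colored_graph G rev c (\<Union>i\<in>{1..n}. Cs i)"
    and relator_verts: "verts G = {1..k}"
    and weights: "\<And>f. f \<in> arcs G \<Longrightarrow> a (rev f) = a f"
  shows "\<exists>(A :: (complex, (nat \<times> 'v word) operator) module) \<iota> E D T.
    ov_prob_space A (mat_alg {1..k}) \<iota> E \<and> D \<in> carrier A \<and> (\<forall>i\<in>{1..n}. T i \<in> carrier A) \<and>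
    (\<forall>p::nat. \<forall>i\<in>{1..k}. \<forall>j\<in>{1..k}.
       E ((D \<oplus>\<^bsub>A\<^esub> (\<Oplus>\<^bsub>A\<^esub>i\<in>{1..n}. T i)) [^]\<^bsub>A\<^esub> p) i j =
       entry (verts (afp_graph n G c Gs es cs)) (afp_jacobi n G c Gs es cs a b ^^ p) (i, []) (j, [])) \<and>
    free_elements A (mat_alg {1..k}) \<iota> E {1..n} T \<and>
    (\<forall>x\<in>carrier A. x \<noteq> D \<longrightarrow> free_pair A (mat_alg {1..k}) \<iota> E D x) \<and>
    (\<forall>i\<in>{1..n}. same_distribution (mat_alg {1..k})
       (mat_alg ({1..k} \<times> verts (Gs i))) (tensor_embed (verts (Gs i))) (tensor_expectation (es i))
       (\<Oplus>\<^bsub>mat_alg ({1..k} \<times> verts (Gs i))\<^esub>\<alpha>\<in>Cs i.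
          tensor (relator_color_mat G c a \<alpha>) (color_adjacency_mat (Gs i) (cs i) \<alpha>))
       A \<iota> E (T i)) \<and>
    same_distribution (mat_alg {1..k}) A \<iota> E D (mat_alg {1..k}) id id (diag_mat {1..k} b)"
proof -
  define K where "K = {1..k}"
  have K: "verts G = K" "finite K" by (simp_all add: K_def relator_verts)
  have G: "fin_digraph G" using relator by (simp add: finite_colored_graph_def)
  have H: "fin_digraph (Gs j)" and root: "es j \<in> verts (Gs j)"
    and col: "\<And>g. g \<in> arcs (Gs j) \<Longrightarrow> cs j g \<in> Cs j" if "j \<in> {1..n}" for j
    using graphs[OF that]
    by (auto simp: finite_rooted_colored_graph_def finite_rooted_colored_graph_axioms_def
        finite_colored_graph_def colored_graph_def colored_graph_axioms_def)
  interpret rooted_family n K Gs es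
    by unfold_locales (use K H root in \<open>auto simp: fin_digraph_def fin_digraph_axioms_def\<close>)
  let ?A = "op_alg V" and ?J = "afp_jacobi n G c Gs es cs a b"
  let ?Y = "\<lambda>j. color_sum_mat G c a (Gs j) (cs j) (Cs j)"
  let ?D = "coeff.amplify (diag_mat K b)" and ?T = "\<lambda>j. factor_op j (?Y j)"
  interpret ov_prob_space ?A "mat_alg K" coeff.amplify vacuum by (rule ov_prob_space_vacuum)
  have Y: "?Y j \<in> carrier (mat_alg (K \<times> verts (Gs j)))" if "j \<in> {1..n}" for j
    using color_sum_mat_closed[of G "Gs j"] K finite_verts[OF that] by simp
  have T: "?T j \<in> carrier ?A" if "j \<in> {1..n}" for j
    by (rule factor_op_closed[OF that])
  have diag: "diag_mat K b \<in> carrier (mat_alg K)"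
    by (simp add: diag_mat_def mat_alg_def)
  let ?S = "?D \<oplus>\<^bsub>?A\<^esub> (\<Oplus>\<^bsub>?A\<^esub>i\<in>{1..n}. ?T i)"
  have S_closed: "?S \<in> carrier ?A"
    using T coeff.amplify_closed by (intro A.add.m_closed A.finsum_closed) auto
  have S: "?S \<xi> = cut V (?J \<xi>)" for \<xi>
  proof (intro ext, clarify)
    fix l u
    show "?S \<xi> (l, u) = cut V (?J \<xi>) (l, u)"
    proof (cases "(l, u) \<in> V")
      case True
      then have l: "l \<in> K" and u: "u \<in> words n Gs es" by auto
      have "?T j \<xi> (l, u) = (\<Sum>f\<in>out_arcs G l. \<Sum>g\<in>out_arcs (Gs j) (fst (split_word es j u)).
         if c f = cs j g then complex_of_real (a f) *
           \<xi> (head G f, prepend es j (head (Gs j) g) (snd (split_word es j u))) else 0)"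
        if j: "j \<in> {1..n}" for j
      proof -
        obtain v w where vw: "split_word es j u = (v, w)" by fastforce
        note d = split_word_words[OF j u vw]
        have lG: "l \<in> verts G" using l K by simp
        show ?thesis
          using factor_op_apply[OF j l d(2,3,1), of "?Y j" \<xi>]
            color_sum_mat_sum[OF G H[OF j] colors_finite[OF j] col[OF j] lG d(1),
              where c = c and a = a and \<eta> = "\<lambda>l' v'. \<xi> (l', prepend es j v' w)"]
          by (simp only: K d(4) vw fst_conv snd_conv)
      qed
      moreover have "?D \<xi> (l, u) = complex_of_real (b l) * \<xi> (l, u)"
        using True K by (simp add: coeff.amplify_def diag_mat_def if_distrib[of "\<lambda>t. t * _"] cong: if_cong)
      ultimately show ?thesis
        using True afp_jacobi_eq[OF G K(1) H l u, where c = c and cs = cs and a = a and b = b and \<xi> = \<xi>]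
        by (simp only: op_alg_simps(4) finsum_op_alg[OF finite_atLeastAtMost T] cut_def if_True
            cong: sum.cong)
    qed (use op_algD(5)[OF S_closed] in \<open>simp only: cut_def if_False\<close>)
  qed
  have paths: "vacuum (?S [^]\<^bsub>?A\<^esub> p) i j = entry (verts (afp_graph n G c Gs es cs)) (?J ^^ p) (i, []) (j, [])"
    if "i \<in> K" for p :: nat and i j
  proof -
    have "(i, []) \<in> V" using that Nil_words by simp
    moreover have "verts (afp_graph n G c Gs es cs) = V" by (simp add: afp_graph_def K)
    ultimately show ?thesis
      by (simp only: entry_eq vacuum_def op_alg_pow[OF S_closed S] cut_def if_True)
  qed
  have T_dist: "same_distribution (mat_alg K) (mat_alg (K \<times> verts (Gs j)))
      (tensor_embed (verts (Gs j))) (tensor_expectation (es j)) (?Y j) ?A coeff.amplify vacuum (?T j)"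
    if j: "j \<in> {1..n}" for j
    by (rule same_distribution_hom[OF ov_prob_space_tensor factor_op_hom[OF j] Y[OF j]])
      (simp_all add: K finite_verts[OF j] root_in[OF j] factor_op_embed[OF j] vacuum_factor_op[OF j])
  have D_dist: "same_distribution (mat_alg K) ?A coeff.amplify vacuum ?D (mat_alg K) id id (diag_mat K b)"
    by (rule same_distribution_sym,
        rule same_distribution_hom[OF ov_prob_space_mat_alg[OF K(2)] coeff.amplify_hom diag])
      (simp_all add: E_embed)
  show ?thesis
    unfolding K_def[symmetric]
    by (intro exI[of _ ?A] exI[of _ coeff.amplify] exI[of _ vacuum] exI[of _ ?D] exI[of _ ?T] conjI ballI allI impI)
      (use ov_prob_space_vacuum coeff.amplify_closed T paths free_factor_op[OF Y]
          free_pair_embed[OF diag] T_dist[unfolded color_sum_mat_def K(1)] D_dist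
        in \<open>simp_all add: color_sum_mat_def K\<close>)
qed

end
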